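(* Let $p \neq 0$ be a real constant. Consider the system of partial differential equations for functions $u(t,x)$, $m(t,x)$: $$m = u - u_{xx}, \qquad m_t = 2p\,u^{p-1}u_x m + u^p m_x + \tfrac{1}{2}p(p-1)u^{p-2}(u^2-u_x^2)u_x .$$ For every $p\neq 0$, the infinitesimal point symmetries admitted by this system are generated by (i.e. the Lie algebra of all infinitesimal point symmetries is the linear span of) the three vector fields $$\mathbf{X}_1 = \partial_x \ (\text{translation in } x),\qquad \mathbf{X}_2 = \partial_t \ (\text{translation in } t),\qquad \mathbf{X}_3 = m\,\partial_m + u\,\partial_u - p\,t\,\partial_t \ (\text{scaling}).$$ In particular, no extra symmetries are admitted for special values of $p\neq 0$. Moreover, all of these symmetries project to point symmetries (on the variables $(t,x,u)$) of the single equation $$u_t - u_{txx} = \tfrac{1}{2}(p+1)(p+2)u^p u_x - \tfrac{1}{2}p(p-1)u^{p-2}u_x^3 - 2p\,u^{p-1}u_x u_{xx} - u^p u_{xxx}.$$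
   Context: An infinitesimal point symmetry of the system $m = u - u_{xx}$, $m_t = 2p\,u^{p-1}u_x m + u^p m_x + \tfrac{1}{2}p(p-1)u^{p-2}(u^2-u_x^2)u_x$ for $(u,m)$ is a vector field $$\mathbf{X} = \tau(t,x,u,m)\partial_t + \xi(t,x,u,m)\partial_x + \eta(t,x,u,m)\partial_u + \phi(t,x,u,m)\partial_m$$ that generates a one-parameter (local) Lie group of transformations on $(t,x,u,m)$ leaving invariant the solution space of the system. The invariance condition is that the prolongation of $\mathbf{X}$ to the derivatives of $u$ and $m$, applied to each equation of the system, vanishes on the solution space of the system. Point symmetries of the single equation $u_t - u_{txx} = \tfrac{1}{2}(p+1)(p+2)u^p u_x - \tfrac{1}{2}p(p-1)u^{p-2}u_x^3 - 2p\,u^{p-1}u_x u_{xx} - u^p u_{xxx}$ for $u(t,x)$ are defined in the same way, with vector fields $\tau(t,x,u)\partial_t + \xi(t,x,u)\partial_x + \eta(t,x,u)\partial_u$; the projection of a vector field $\mathbf{X} = \tau\partial_t + \xi\partial_x + \eta\partial_u + \phi\partial_m$ on $(t,x,u,m)$, when $\tau,\xi,\eta$ do not depend on $m$, is the vector field $\tau\partial_t + \xi\partial_x + \eta\partial_u$ on $(t,x,u)$ obtained by dropping its $\partial_m$ term. The single equation is the one obtained from the system by eliminating $m$. *)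

theory Defs
  imports "HOL-Analysis.Analysis" "HOL-Library.Groups_Big_Fun"
begin

section \<open>Smooth maps\<close>

primrec Ck_on :: "nat \<Rightarrow> 'a::real_normed_vector set \<Rightarrow> ('a \<Rightarrow> 'b::real_normed_vector) \<Rightarrow> bool" where
  "Ck_on 0 S f \<longleftrightarrow> continuous_on S f"
| "Ck_on (Suc n) S f \<longleftrightarrow>
     (\<forall>z\<in>S. f differentiable (at z)) \<and> (\<forall>v. Ck_on n S (\<lambda>z. frechet_derivative f (at z) v))"

definition smooth_on :: "'a::real_normed_vector set \<Rightarrow> ('a \<Rightarrow> 'b::real_normed_vector) \<Rightarrow> bool" where
  "smooth_on S f \<longleftrightarrow> (\<forall>n. Ck_on n S f)"


section \<open>Jets of functions of \<open>(t, x)\<close>\<close>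

text \<open>
  Points \<open>(t, x, q)\<close> of the space of independent and dependent variables; the dependent
  variables are indexed by the finite type \<open>'d\<close>. Since this space is a vector space, a vector
  field \<open>\<tau> \<partial>\<^sub>t + \<xi> \<partial>\<^sub>x + \<Sum>\<^sub>\<alpha> \<eta>\<^sub>\<alpha> \<partial>\<^bsub>q\<alpha>\<^esub>\<close> on it is the map with components \<open>(\<tau>, \<xi>, \<eta>)\<close>.
\<close>
type_synonym 'd pnt = "real \<times> real \<times> (real ^ 'd)"
type_synonym 'd vfield = "'d pnt \<Rightarrow> 'd pnt"

text \<open>
  Infinite jets \<open>(t, x, w)\<close>: the coordinate \<open>w (\<alpha>, i, j)\<close> stands for the derivative
  \<open>\<partial>\<^sub>t\<^sup>i \<partial>\<^sub>x\<^sup>j\<close> of the dependent variable \<open>\<alpha>\<close>.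
\<close>
type_synonym 'd jet = "real \<times> real \<times> ('d \<times> nat \<times> nat \<Rightarrow> real)"

definition base :: "('d::finite) jet \<Rightarrow> 'd pnt" where
  "base = (\<lambda>(t, x, w). (t, x, \<chi> \<alpha>. w (\<alpha>, 0, 0)))"

definition pd_t :: "('d jet \<Rightarrow> real) \<Rightarrow> 'd jet \<Rightarrow> real" where
  "pd_t f = (\<lambda>(t, x, w). deriv (\<lambda>s. f (s, x, w)) t)"

definition pd_x :: "('d jet \<Rightarrow> real) \<Rightarrow> 'd jet \<Rightarrow> real" where
  "pd_x f = (\<lambda>(t, x, w). deriv (\<lambda>s. f (t, s, w)) x)"

definition pd_w :: "'d \<times> nat \<times> nat \<Rightarrow> ('d jet \<Rightarrow> real) \<Rightarrow> 'd jet \<Rightarrow> real" where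
  "pd_w k f = (\<lambda>(t, x, w). deriv (\<lambda>s. f (t, x, w(k := s))) (w k))"

text \<open>
  Total derivatives. They are applied to functions of finitely many jet coordinates only, for
  which the formally infinite sums have finitely many nonzero terms, so that \<^const>\<open>Sum_any\<close>
  (the sum over the support of the summand) is the intended sum.
\<close>
definition Dt :: "('d jet \<Rightarrow> real) \<Rightarrow> 'd jet \<Rightarrow> real" where
  "Dt f = (\<lambda>(t, x, w). pd_t f (t, x, w) +
     Sum_any (\<lambda>(\<alpha>, i, j). w (\<alpha>, Suc i, j) * pd_w (\<alpha>, i, j) f (t, x, w)))"

definition Dx :: "('d jet \<Rightarrow> real) \<Rightarrow> 'd jet \<Rightarrow> real" where
  "Dx f = (\<lambda>(t, x, w). pd_x f (t, x, w) +
     Sum_any (\<lambda>(\<alpha>, i, j). w (\<alpha>, i, Suc j) * pd_w (\<alpha>, i, j) f (t, x, w)))"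


section \<open>Prolongation and infinitesimal point symmetries\<close>

definition vf_tau :: "'d vfield \<Rightarrow> ('d::finite) jet \<Rightarrow> real" where
  "vf_tau X z = fst (X (base z))"

definition vf_xi :: "'d vfield \<Rightarrow> ('d::finite) jet \<Rightarrow> real" where
  "vf_xi X z = fst (snd (X (base z)))"

definition vf_eta :: "'d vfield \<Rightarrow> 'd \<Rightarrow> ('d::finite) jet \<Rightarrow> real" where
  "vf_eta X \<alpha> z = snd (snd (X (base z))) $ \<alpha>"

text \<open>The characteristic \<open>Q\<^sub>\<alpha> = \<eta>\<^sub>\<alpha> - \<tau> q\<^bsub>\<alpha>,t\<^esub> - \<xi> q\<^bsub>\<alpha>,x\<^esub>\<close>.\<close>
definition characteristic :: "'d vfield \<Rightarrow> 'd \<Rightarrow> ('d::finite) jet \<Rightarrow> real" where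
  "characteristic X \<alpha> = (\<lambda>(t, x, w). vf_eta X \<alpha> (t, x, w)
     - vf_tau X (t, x, w) * w (\<alpha>, 1, 0) - vf_xi X (t, x, w) * w (\<alpha>, 0, 1))"

text \<open>
  The component of the prolonged vector field along \<open>w (\<alpha>, i, j)\<close>, by the general prolongation
  formula \<open>D\<^sub>t\<^sup>i D\<^sub>x\<^sup>j Q\<^sub>\<alpha> + \<tau> w\<^bsub>\<alpha>,i+1,j\<^esub> + \<xi> w\<^bsub>\<alpha>,i,j+1\<^esub>\<close>; for \<open>i = j = 0\<close> it is \<open>\<eta>\<^sub>\<alpha>\<close>.
\<close>
definition prol_coeff :: "'d vfield \<Rightarrow> 'd \<times> nat \<times> nat \<Rightarrow> ('d::finite) jet \<Rightarrow> real" where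
  "prol_coeff X = (\<lambda>(\<alpha>, i, j) (t, x, w).
     (Dt ^^ i) ((Dx ^^ j) (characteristic X \<alpha>)) (t, x, w)
     + vf_tau X (t, x, w) * w (\<alpha>, Suc i, j) + vf_xi X (t, x, w) * w (\<alpha>, i, Suc j))"

definition prolong :: "'d vfield \<Rightarrow> (('d::finite) jet \<Rightarrow> real) \<Rightarrow> 'd jet \<Rightarrow> real" where
  "prolong X F z = vf_tau X z * pd_t F z + vf_xi X z * pd_x F z
     + Sum_any (\<lambda>k. prol_coeff X k z * pd_w k F z)"

text \<open>
  A system \<open>F = 0\<close> for \<open>F \<in> \<Delta>\<close>: its solution space in the jet space over \<open>D\<close> is cut out by the
  equations together with all their differential consequences.
\<close>
definition solution_space :: "'d pnt set \<Rightarrow> (('d::finite) jet \<Rightarrow> real) set \<Rightarrow> 'd jet set" where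
  "solution_space D \<Delta> =
     {z. base z \<in> D \<and> (\<forall>F\<in>\<Delta>. \<forall>i j. (Dt ^^ i) ((Dx ^^ j) F) z = 0)}"

definition point_symmetry :: "'d pnt set \<Rightarrow> (('d::finite) jet \<Rightarrow> real) set \<Rightarrow> 'd vfield \<Rightarrow> bool" where
  "point_symmetry D \<Delta> X \<longleftrightarrow>
     smooth_on D X \<and> (\<forall>F\<in>\<Delta>. \<forall>z\<in>solution_space D \<Delta>. prolong X F z = 0)"


section \<open>The equations\<close>

text \<open>
  Real powers \<open>u\<^sup>a\<close>: equal to \<open>u powr a\<close> for \<open>u > 0\<close>, and for integer exponents the usual integer
  power of an arbitrary real \<open>u\<close>.
\<close>
definition rpow :: "real \<Rightarrow> real \<Rightarrow> real" where
  "rpow u a = (if a \<in> \<int> then u powi \<lfloor>a\<rfloor> else u powr a)"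

text \<open>
  The values of \<open>u\<close> at which the coefficients of the equations are defined and smooth. For \<open>p = 1\<close>
  the coefficient \<open>p (p - 1) u\<^bsup>p-2\<^esup>\<close> vanishes identically, so \<open>u = 0\<close> is allowed there too.
\<close>
definition admissible :: "real \<Rightarrow> real set" where
  "admissible p = {u. u > 0 \<or> p \<in> \<int> \<and> (u \<noteq> 0 \<or> p > 0)}"

text \<open>For the system, the dependent variables are \<open>u\<close> (index 1) and \<open>m\<close> (index 2).\<close>

definition eq_m :: "2 jet \<Rightarrow> real" where
  "eq_m = (\<lambda>(t, x, w).
     let u = w (1, 0, 0); u_xx = w (1, 0, 2); m = w (2, 0, 0)
     in m - (u - u_xx))"

definition eq_mt :: "real \<Rightarrow> 2 jet \<Rightarrow> real" where
  "eq_mt p = (\<lambda>(t, x, w).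
     let u = w (1, 0, 0); u_x = w (1, 0, 1);
         m = w (2, 0, 0); m_t = w (2, 1, 0); m_x = w (2, 0, 1)
     in m_t - (2 * p * rpow u (p - 1) * u_x * m + rpow u p * m_x
          + 1/2 * p * (p - 1) * rpow u (p - 2) * (u\<^sup>2 - u_x\<^sup>2) * u_x))"

definition um_system :: "real \<Rightarrow> (2 jet \<Rightarrow> real) set" where
  "um_system p = {eq_m, eq_mt p}"

definition eq_u :: "real \<Rightarrow> 1 jet \<Rightarrow> real" where
  "eq_u p = (\<lambda>(t, x, w).
     let u = w (1, 0, 0); u_t = w (1, 1, 0); u_x = w (1, 0, 1);
         u_xx = w (1, 0, 2); u_xxx = w (1, 0, 3); u_txx = w (1, 1, 2)
     in u_t - u_txx - (1/2 * (p + 1) * (p + 2) * rpow u p * u_x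
          - 1/2 * p * (p - 1) * rpow u (p - 2) * u_x ^ 3
          - 2 * p * rpow u (p - 1) * u_x * u_xx - rpow u p * u_xxx))"


section \<open>The vector fields\<close>

definition X1 :: "2 vfield" where
  "X1 = (\<lambda>(t, x, q). (0, 1, 0))"

definition X2 :: "2 vfield" where
  "X2 = (\<lambda>(t, x, q). (1, 0, 0))"

text \<open>\<open>m \<partial>\<^sub>m + u \<partial>\<^sub>u - p t \<partial>\<^sub>t\<close>\<close>
definition X3 :: "real \<Rightarrow> 2 vfield" where
  "X3 p = (\<lambda>(t, x, q). (- p * t, 0, vector [q $ 1, q $ 2]))"

text \<open>The map \<open>(t, x, u, m) \<mapsto> (t, x, u)\<close>, which on tangent vectors drops the \<open>\<partial>\<^sub>m\<close> term.\<close>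
definition drop_m :: "2 pnt \<Rightarrow> 1 pnt" where
  "drop_m = (\<lambda>(t, x, q). (t, x, vector [q $ 1]))"

text \<open>
  \<open>Y\<close> is the projection of \<open>X\<close>. Such a \<open>Y\<close> exists iff the \<open>\<partial>\<^sub>t\<close>, \<open>\<partial>\<^sub>x\<close>, \<open>\<partial>\<^sub>u\<close> components of \<open>X\<close>
  do not depend on \<open>m\<close>, and it is then unique on \<open>drop_m ` D\<close>.
\<close>
definition projects_to :: "2 pnt set \<Rightarrow> 2 vfield \<Rightarrow> 1 vfield \<Rightarrow> bool" where
  "projects_to D X Y \<longleftrightarrow> (\<forall>z\<in>D. Y (drop_m z) = drop_m (X z))"

end

theory Submission
  imports Defs
begin

text \<open>
  On the solution space \<open>u\<^sub>x\<^sub>x = u - m\<close>, and \<open>m\<^sub>t\<close> is given by the evolution equation, while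
  \<open>u, m, u\<^sub>t, u\<^sub>x, u\<^sub>t\<^sub>x, m\<^sub>x, m\<^sub>x\<^sub>x\<close> are free. Both invariance conditions are polynomial in the free
  derivatives, so their coefficients vanish. The first condition yields \<open>\<tau> = \<tau>(t)\<close>, \<open>\<xi> = \<xi>(t, x)\<close>,
  \<open>\<eta>\<^sub>m = 0\<close>, \<open>\<eta>\<^sub>u\<^sub>u = 0\<close>, \<open>2 \<eta>\<^sub>x\<^sub>u = \<xi>\<^sub>x\<^sub>x\<close> and expresses \<open>\<phi>\<close> by \<open>\<eta>\<close> and \<open>\<xi>\<close>. The second one then forces,
  where \<open>u \<noteq> 0\<close>, that \<open>\<xi>\<close> and \<open>\<tau>\<^sub>t\<close> are locally constant and \<open>p \<eta> = - \<tau>\<^sub>t u\<close>, \<open>p \<phi> = - \<tau>\<^sub>t m\<close>; the cases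
  \<open>p = 1\<close> and \<open>p \<noteq> 1\<close> differ because the coefficient of \<open>u\<^sub>x\<^sup>2\<close> is \<open>p (p - 1) u\<^bsup>p-2\<^esup> \<eta>\<^sub>x\<close> up to a constant
  factor. As \<open>u \<noteq> 0\<close> on a dense open subset, continuity extends these equations to \<open>D\<close>, and
  connectedness makes the constants global.
\<close>

section \<open>Directional derivatives of smooth maps\<close>

text \<open>\<open>solution_space\<close> imposes every differential consequence, so coefficients
  can be compared only on jets that satisfy infinitely many equations and still have prescribed
  low-order coordinates. These jets are formal: they are built one order in t at a time from the
  solved form of \<open>eq_mt\<close>, so neither an existence theorem nor a formula for higher
  derivatives of \<open>rpow\<close> enters. For the converse, prolonging a field (b - c p t, a, c
  q) multiplies the coordinate w(\<alpha>, i, j) by c (1 + i p). The system and the single equation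
  are homogeneous for this weight, which settles both that combinations of \<open>X1\<close>,
  \<open>X2\<close>, \<open>X3\<close> are symmetries and that their projections are. The delicate
  value is u = 0: negative powers can occur there for p = 1 and p = 2, and they are kept together
  with the vanishing factors p - 1 and p - 2.\<close>

definition ddir :: "'a::real_normed_vector \<Rightarrow> ('a \<Rightarrow> 'b::real_normed_vector) \<Rightarrow> 'a \<Rightarrow> 'b" where
  "ddir v f z = frechet_derivative f (at z) v"

lemma has_derivative_ddir:
  "f differentiable (at z) \<Longrightarrow> (f has_derivative (\<lambda>v. ddir v f z)) (at z)"
  by (simp add: ddir_def frechet_derivative_works)

lemma ddir_eqI: "(f has_derivative f') (at z) \<Longrightarrow> ddir v f z = f' v"
  by (metis ddir_def frechet_derivative_at)

lemma linear_ddir: "f differentiable (at z) \<Longrightarrow> linear (\<lambda>v. ddir v f z)"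
  using has_derivative_ddir has_derivative_linear by blast

lemma differentiable_cong_open:
  assumes "open S" "z \<in> S" "\<And>y. y \<in> S \<Longrightarrow> f y = g y" "f differentiable (at z)"
  shows "g differentiable (at z)"
  using assms has_derivative_transform_within_open unfolding differentiable_def by metis

lemma ddir_cong_open:
  assumes "open S" "z \<in> S" "\<And>y. y \<in> S \<Longrightarrow> f y = g y" "f differentiable (at z)"
  shows "ddir v f z = ddir v g z"
  using frechet_derivative_transform_within_open[of f z S g] assms by (simp add: ddir_def)

lemma Ck_on_cong_open:
  assumes "open S" "\<And>y. y \<in> S \<Longrightarrow> f y = g y" "Ck_on n S f"
  shows "Ck_on n S g"
  using assms(2,3)
proof (induction n arbitrary: f g)
  case 0
  then show ?case by (simp cong: continuous_on_cong)
next
  case (Suc n)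
  have d: "f differentiable (at z)" if "z \<in> S" for z
    using Suc.prems that by simp
  have "g differentiable (at z)" if "z \<in> S" for z
    using differentiable_cong_open[OF assms(1) that Suc.prems(1) d[OF that]] by blast
  moreover have "Ck_on n S (\<lambda>z. frechet_derivative g (at z) v)" for v
  proof (rule Suc.IH)
    show "Ck_on n S (\<lambda>z. frechet_derivative f (at z) v)"
      using Suc.prems by simp
    show "frechet_derivative f (at y) v = frechet_derivative g (at y) v" if "y \<in> S" for y
      using ddir_cong_open[OF assms(1) that Suc.prems(1) d[OF that]] by (simp add: ddir_def)
  qed
  ultimately show ?case by simp
qed

lemma smooth_on_cong_open:
  "open S \<Longrightarrow> (\<And>y. y \<in> S \<Longrightarrow> f y = g y) \<Longrightarrow> smooth_on S f \<Longrightarrow> smooth_on S g"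
  unfolding smooth_on_def using Ck_on_cong_open by blast

lemma Ck_on_bounded_linear_comp:
  assumes "open S" "bounded_linear L" "Ck_on n S f"
  shows "Ck_on n S (\<lambda>z. L (f z))"
  using assms(3)
proof (induction n arbitrary: f)
  case 0
  then show ?case
    using bounded_linear.continuous_on[OF assms(2)] by simp
next
  case (Suc n)
  have *: "((\<lambda>z. L (f z)) has_derivative (\<lambda>v. L (frechet_derivative f (at z) v))) (at z)"
    if "z \<in> S" for z
    by (rule bounded_linear.has_derivative[OF assms(2)])
      (use Suc.prems that in \<open>simp add: frechet_derivative_works[symmetric]\<close>)
  have "Ck_on n S (\<lambda>z. frechet_derivative (\<lambda>z. L (f z)) (at z) v)" for v
  proof (rule Ck_on_cong_open[OF assms(1)])
    show "Ck_on n S (\<lambda>z. L (frechet_derivative f (at z) v))"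
      using Suc by simp
  qed (metis * frechet_derivative_at)
  then show ?case
    using * by (auto simp: differentiable_def)
qed

lemma smooth_on_bounded_linear_comp:
  "open S \<Longrightarrow> bounded_linear L \<Longrightarrow> smooth_on S f \<Longrightarrow> smooth_on S (\<lambda>z. L (f z))"
  unfolding smooth_on_def using Ck_on_bounded_linear_comp by blast

lemma Ck_on_const: "Ck_on n S (\<lambda>z. c)"
  by (induction n arbitrary: c) auto

lemma smooth_on_affine:
  assumes "bounded_linear L"
  shows "smooth_on S (\<lambda>z. c + L z)"
  unfolding smooth_on_def
proof
  fix n
  have *: "((\<lambda>z. c + L z) has_derivative L) (at z)" for z
    using has_derivative_add[OF has_derivative_const bounded_linear_imp_has_derivative[OF assms]]
    by fastforce
  then have "frechet_derivative (\<lambda>z. c + L z) (at z) = L" for z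
    by (metis frechet_derivative_at)
  moreover have "continuous_on S (\<lambda>z. c + L z)"
    by (intro continuous_on_add continuous_on_const linear_continuous_on assms)
  ultimately show "Ck_on n S (\<lambda>z. c + L z)"
    using * by (cases n) (auto simp: Ck_on_const differentiable_def)
qed

lemma smooth_on_differentiable: "smooth_on S f \<Longrightarrow> z \<in> S \<Longrightarrow> f differentiable (at z)"
  unfolding smooth_on_def by (metis Ck_on.simps(2))

lemma smooth_on_ddir: "smooth_on S f \<Longrightarrow> smooth_on S (ddir v f)"
  unfolding smooth_on_def ddir_def by (metis Ck_on.simps(2))

lemma smooth_on_imp_continuous_on: "smooth_on S f \<Longrightarrow> continuous_on S f"
  unfolding smooth_on_def by (metis Ck_on.simps(1))

text \<open>This replaces the symmetry of second derivatives: \<open>f\<close> is locally constant along \<open>v\<close>, hence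
  so is \<open>ddir w f\<close>.\<close>
lemma ddir_ddir_eq_0:
  fixes f :: "'a::real_normed_vector \<Rightarrow> real"
  assumes "open S" "smooth_on S f" "\<And>y. y \<in> S \<Longrightarrow> ddir v f y = 0" "z \<in> S"
  shows "ddir v (ddir w f) z = 0"
proof -
  obtain e where e: "e > 0" "ball z e \<subseteq> S"
    using assms(1,4) open_contains_ball by blast
  \<comment> \<open>The added 1 keeps the quotient meaningful for v = 0. A shift by s v with |s| < d
    has length below e/2, so it carries \<open>ball z (e/2)\<close> into
    \<open>ball z e\<close>.\<close>
  define d where "d = e / (2 * (norm v + 1))"
  have d: "d > 0" "d * norm v < e / 2"
    using e(1) by (auto simp: d_def field_simps add_pos_nonneg)
  have const: "f (y + s *\<^sub>R v) = f y" if y: "y \<in> ball z (e/2)" and s: "\<bar>s\<bar> < d" for y s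
  proof -
    have sv: "norm (r *\<^sub>R v) < e/2" if "\<bar>r\<bar> < d" for r
      using that d mult_right_mono[of "\<bar>r\<bar>" d "norm v"] by simp
    have inS: "y + r *\<^sub>R v \<in> S" if "\<bar>r\<bar> < d" for r
    proof -
      have "dist z (y + r *\<^sub>R v) \<le> dist z y + norm (r *\<^sub>R v)"
        by (metis dist_triangle dist_add_cancel dist_0_norm add.right_neutral)
      then show ?thesis
        using sv[OF that] y e(2) by (auto simp: subset_iff)
    qed
    have "((\<lambda>r. f (y + r *\<^sub>R v)) has_derivative (\<lambda>h. 0)) (at r within {-d<..<d})"
      if "r \<in> {-d<..<d}" for r
    proof -
      have r: "y + r *\<^sub>R v \<in> S" using inS that by auto
      have "((\<lambda>r. f (y + r *\<^sub>R v)) has_derivative (\<lambda>h. ddir (h *\<^sub>R v) f (y + r *\<^sub>R v))) (at r)"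
        by (rule has_derivative_compose[where f = "\<lambda>r. y + r *\<^sub>R v",
              OF _ has_derivative_ddir[OF smooth_on_differentiable[OF assms(2) r]]]) (auto intro!: derivative_eq_intros)
      moreover have "ddir (h *\<^sub>R v) f (y + r *\<^sub>R v) = 0" for h
        using linear_cmul[OF linear_ddir[OF smooth_on_differentiable[OF assms(2) r]], of h v]
          assms(3)[OF r] by simp
      ultimately show ?thesis
        using has_derivative_at_withinI by fastforce
    qed
    then have "\<exists>c. \<forall>r\<in>{-d<..<d}. f (y + r *\<^sub>R v) = c"
      by (intro has_derivative_zero_constant) auto
    then show ?thesis
      using s d(1) by (metis abs_less_iff add.right_neutral greaterThanLessThan_iff minus_less_iff
          neg_less_0_iff_less scaleR_zero_left)
  qed
  \<comment> \<open>Near z the function agrees with its own translate by s v, so its derivative at z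
    + s v is its derivative at z.\<close>
  have cw: "ddir w f (z + s *\<^sub>R v) = ddir w f z" if s: "\<bar>s\<bar> < d" for s
  proof -
    have zs: "z + s *\<^sub>R v \<in> S"
    proof -
      have "norm (s *\<^sub>R v) < e"
        using s d e(1) mult_right_mono[of "\<bar>s\<bar>" d "norm v"] by simp
      then show ?thesis
        using e(2) by (auto simp: subset_iff dist_norm)
    qed
    have "((\<lambda>y. f (y + s *\<^sub>R v)) has_derivative (\<lambda>h. ddir h f (z + s *\<^sub>R v))) (at z)"
      by (rule has_derivative_compose[where f = "\<lambda>y. y + s *\<^sub>R v",
            OF _ has_derivative_ddir[OF smooth_on_differentiable[OF assms(2) zs]]]) (auto intro!: derivative_eq_intros)
    then have "(f has_derivative (\<lambda>h. ddir h f (z + s *\<^sub>R v))) (at z)"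
      by (rule has_derivative_transform_within_open[OF _ open_ball[of z "e/2"]])
        (use const s e(1) in auto)
    then show ?thesis
      by (simp add: ddir_eqI)
  qed
  have "((\<lambda>s. ddir w f (z + s *\<^sub>R v)) has_derivative (\<lambda>h. ddir (h *\<^sub>R v) (ddir w f) z)) (at 0)"
    by (rule has_derivative_compose[of "\<lambda>s. z + s *\<^sub>R v"])
      (use has_derivative_ddir[OF smooth_on_differentiable[OF smooth_on_ddir[OF assms(2)] assms(4)]]
        in \<open>auto intro!: derivative_eq_intros\<close>)
  moreover have "((\<lambda>s. ddir w f (z + s *\<^sub>R v)) has_derivative (\<lambda>h. 0)) (at 0)"
    by (rule has_derivative_transform_within_open[OF has_derivative_const[of "ddir w f z"]
          open_greaterThanLessThan[of "-d" d]]) (use cw d(1) in auto)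
  ultimately have "(\<lambda>h. ddir (h *\<^sub>R v) (ddir w f) z) = (\<lambda>h::real. 0)"
    using has_derivative_unique by blast
  then show ?thesis
    by (metis scaleR_one)
qed

section \<open>Derivations on jet functions\<close>

text \<open>The derivation \<open>a \<partial>\<^sub>t + b \<partial>\<^sub>x + \<Sum>\<^sub>k c\<^sub>k \<partial>\<^bsub>w k\<^esub>\<close> at a jet: the total derivatives and the
  prolongation are instances. The support condition excludes the junk value of \<^const>\<open>Sum_any\<close>.\<close>
definition has_jderiv :: "real \<Rightarrow> real \<Rightarrow> ('d \<times> nat \<times> nat \<Rightarrow> real) \<Rightarrow> ('d jet \<Rightarrow> real) \<Rightarrow> 'd jet \<Rightarrow> real \<Rightarrow> bool" where
  "has_jderiv a b c f = (\<lambda>(t, x, w) d. \<exists>ft fx fw.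
     ((\<lambda>s. f (s, x, w)) has_real_derivative ft) (at t) \<and>
     ((\<lambda>s. f (t, s, w)) has_real_derivative fx) (at x) \<and>
     (\<forall>k. ((\<lambda>s. f (t, x, w(k := s))) has_real_derivative fw k) (at (w k))) \<and>
     finite {k. fw k \<noteq> 0} \<and> d = a * ft + b * fx + Sum_any (\<lambda>k. c k * fw k))"

definition coord :: "'d \<times> nat \<times> nat \<Rightarrow> 'd jet \<Rightarrow> real" where
  "coord k z = snd (snd z) k"

lemma coord_simp [simp]: "coord k (t, x, w) = w k"
  by (simp add: coord_def)

lemma has_jderiv_eq_rhs: "has_jderiv a b c f z d \<Longrightarrow> d = e \<Longrightarrow> has_jderiv a b c f z e"
  by simp

text \<open>The partials \<open>pd_t\<close>, \<open>pd_x\<close>, \<open>pd_w\<close> are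
  \<open>deriv\<close>s, defined even where no derivative exists; the witnesses in
  \<open>has_jderiv\<close> certify them as genuine. This is the bridge from the derivation rules to
  \<open>Dt\<close>, \<open>Dx\<close> and \<open>prolong\<close>.\<close>

lemma jderiv_eq:
  assumes "has_jderiv a b c f z d"
  shows "d = a * pd_t f z + b * pd_x f z + Sum_any (\<lambda>k. c k * pd_w k f z)"
proof -
  obtain t x w where z: "z = (t, x, w)" by (cases z) auto
  obtain ft fx fw where *: "((\<lambda>s. f (s, x, w)) has_real_derivative ft) (at t)"
     "((\<lambda>s. f (t, s, w)) has_real_derivative fx) (at x)"
     "\<And>k. ((\<lambda>s. f (t, x, w(k := s))) has_real_derivative fw k) (at (w k))"
     "d = a * ft + b * fx + Sum_any (\<lambda>k. c k * fw k)"
    using assms by (auto simp: has_jderiv_def z)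
  have "pd_t f z = ft" "pd_x f z = fx" "pd_w k f z = fw k" for k
    using *(1-3) by (simp_all add: z pd_t_def pd_x_def pd_w_def DERIV_imp_deriv)
  then show ?thesis using *(4) by simp
qed

lemma Dt_eqI:
  assumes "has_jderiv 1 0 (\<lambda>(\<alpha>, i, j). w (\<alpha>, Suc i, j)) f (t, x, w) d"
  shows "Dt f (t, x, w) = d"
proof -
  have "(\<lambda>k. (case k of (\<alpha>, i, j) \<Rightarrow> w (\<alpha>, Suc i, j)) * pd_w k f (t, x, w)) =
    (\<lambda>(\<alpha>, i, j). w (\<alpha>, Suc i, j) * pd_w (\<alpha>, i, j) f (t, x, w))" by auto
  then show ?thesis
    using jderiv_eq[OF assms] by (simp add: Dt_def cong del: Sum_any.cong)
qed

lemma Dx_eqI: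
  assumes "has_jderiv 0 1 (\<lambda>(\<alpha>, i, j). w (\<alpha>, i, Suc j)) f (t, x, w) d"
  shows "Dx f (t, x, w) = d"
proof -
  have "(\<lambda>k. (case k of (\<alpha>, i, j) \<Rightarrow> w (\<alpha>, i, Suc j)) * pd_w k f (t, x, w)) =
    (\<lambda>(\<alpha>, i, j). w (\<alpha>, i, Suc j) * pd_w (\<alpha>, i, j) f (t, x, w))" by auto
  then show ?thesis
    using jderiv_eq[OF assms] by (simp add: Dx_def cong del: Sum_any.cong)
qed

lemma prolong_eqI:
  assumes "has_jderiv (vf_tau X z) (vf_xi X z) (\<lambda>k. prol_coeff X k z) F z d"
  shows "prolong X F z = d"
  using jderiv_eq[OF assms] by (simp add: prolong_def)

lemma has_jderiv_const: "has_jderiv a b c (\<lambda>y. r) z 0"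
  unfolding has_jderiv_def
  by (cases z) (auto intro!: exI[of _ 0] exI[of _ "\<lambda>_. 0"] derivative_eq_intros)

lemma has_jderiv_coord: "has_jderiv a b c (\<lambda>y. coord k y) z (c k)"
proof -
  have "Sum_any (\<lambda>l. c l * (if l = k then 1 else 0)) = Sum_any (\<lambda>l. if l = k then c l else 0)"
    by (rule Sum_any.cong) auto
  then have [simp]: "Sum_any (\<lambda>l. c l * (if l = k then 1 else 0)) = c k"
    by simp
  show ?thesis
    unfolding has_jderiv_def
    by (cases z) (auto intro!: exI[of _ 0] exI[of _ "\<lambda>l. if l = k then 1 else 0"] derivative_eq_intros)
qed

text \<open>\<open>Sum_any\<close> is additive on finitely supported summands; the support clause of
  \<open>has_jderiv\<close> provides this and is inherited through the union of the two
  supports.\<close>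

lemma has_jderiv_add:
  assumes "has_jderiv a b c f z d" "has_jderiv a b c g z e"
  shows "has_jderiv a b c (\<lambda>y. f y + g y) z (d + e)"
proof -
  obtain t x w where z: "z = (t, x, w)" by (cases z) auto
  obtain ft fx fw where f: "((\<lambda>s. f (s, x, w)) has_real_derivative ft) (at t)"
     "((\<lambda>s. f (t, s, w)) has_real_derivative fx) (at x)"
     "\<And>k. ((\<lambda>s. f (t, x, w(k := s))) has_real_derivative fw k) (at (w k))"
     "finite {k. fw k \<noteq> 0}" "d = a * ft + b * fx + Sum_any (\<lambda>k. c k * fw k)"
    using assms(1) by (auto simp: has_jderiv_def z)
  obtain gt gx gw where g: "((\<lambda>s. g (s, x, w)) has_real_derivative gt) (at t)"
     "((\<lambda>s. g (t, s, w)) has_real_derivative gx) (at x)"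
     "\<And>k. ((\<lambda>s. g (t, x, w(k := s))) has_real_derivative gw k) (at (w k))"
     "finite {k. gw k \<noteq> 0}" "e = a * gt + b * gx + Sum_any (\<lambda>k. c k * gw k)"
    using assms(2) by (auto simp: has_jderiv_def z)
  have fin: "finite {k. c k * fw k \<noteq> 0}" "finite {k. c k * gw k \<noteq> 0}"
    by (auto intro: finite_subset[OF _ f(4)] finite_subset[OF _ g(4)])
  have "Sum_any (\<lambda>k. c k * (fw k + gw k)) = Sum_any (\<lambda>k. c k * fw k) + Sum_any (\<lambda>k. c k * gw k)"
    by (simp add: Sum_any.distrib[OF fin, symmetric] distrib_left)
  moreover have "finite {k. fw k + gw k \<noteq> 0}"
    by (rule finite_subset[OF _ finite_UnI[OF f(4) g(4)]]) auto
  ultimately show ?thesis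
    unfolding has_jderiv_def z prod.case
    by (intro exI[of _ "ft + gt"] exI[of _ "fx + gx"] exI[of _ "\<lambda>k. fw k + gw k"])
      (auto intro!: DERIV_add f(1-3) g(1-3) simp: f(5) g(5) algebra_simps)
qed

lemma has_jderiv_mult:
  assumes "has_jderiv a b c f z d" "has_jderiv a b c g z e"
  shows "has_jderiv a b c (\<lambda>y. f y * g y) z (d * g z + f z * e)"
proof -
  obtain t x w where z: "z = (t, x, w)" by (cases z) auto
  obtain ft fx fw where f: "((\<lambda>s. f (s, x, w)) has_real_derivative ft) (at t)"
     "((\<lambda>s. f (t, s, w)) has_real_derivative fx) (at x)"
     "\<And>k. ((\<lambda>s. f (t, x, w(k := s))) has_real_derivative fw k) (at (w k))"
     "finite {k. fw k \<noteq> 0}" "d = a * ft + b * fx + Sum_any (\<lambda>k. c k * fw k)"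
    using assms(1) by (auto simp: has_jderiv_def z)
  obtain gt gx gw where g: "((\<lambda>s. g (s, x, w)) has_real_derivative gt) (at t)"
     "((\<lambda>s. g (t, s, w)) has_real_derivative gx) (at x)"
     "\<And>k. ((\<lambda>s. g (t, x, w(k := s))) has_real_derivative gw k) (at (w k))"
     "finite {k. gw k \<noteq> 0}" "e = a * gt + b * gx + Sum_any (\<lambda>k. c k * gw k)"
    using assms(2) by (auto simp: has_jderiv_def z)
  have fin: "finite {k. c k * fw k \<noteq> 0}" "finite {k. c k * gw k \<noteq> 0}"
      "finite {k. c k * fw k * g z \<noteq> 0}" "finite {k. f z * (c k * gw k) \<noteq> 0}"
    by (auto intro: finite_subset[OF _ f(4)] finite_subset[OF _ g(4)])
  have "Sum_any (\<lambda>k. c k * (fw k * g z + gw k * f z))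
      = Sum_any (\<lambda>k. c k * fw k * g z) + Sum_any (\<lambda>k. f z * (c k * gw k))"
    by (subst Sum_any.distrib[OF fin(3,4), symmetric]) (simp add: algebra_simps)
  also have "\<dots> = Sum_any (\<lambda>k. c k * fw k) * g z + f z * Sum_any (\<lambda>k. c k * gw k)"
    by (simp add: Sum_any_left_distrib[OF fin(1)] Sum_any_right_distrib[OF fin(2)])
  finally have "Sum_any (\<lambda>k. c k * (fw k * g z + gw k * f z))
      = Sum_any (\<lambda>k. c k * fw k) * g z + f z * Sum_any (\<lambda>k. c k * gw k)" .
  moreover have "finite {k. fw k * g z + gw k * f z \<noteq> 0}"
    by (rule finite_subset[OF _ finite_UnI[OF f(4) g(4)]]) auto
  moreover have "((\<lambda>s. f (t, x, w(k := s)) * g (t, x, w(k := s))) has_real_derivative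
      fw k * g z + gw k * f z) (at (w k))" for k
    using DERIV_mult[OF f(3)[of k] g(3)[of k]] by (simp add: z)
  moreover have "((\<lambda>s. f (s, x, w) * g (s, x, w)) has_real_derivative ft * g z + gt * f z) (at t)"
    using DERIV_mult[OF f(1) g(1)] by (simp add: z)
  moreover have "((\<lambda>s. f (t, s, w) * g (t, s, w)) has_real_derivative fx * g z + gx * f z) (at x)"
    using DERIV_mult[OF f(2) g(2)] by (simp add: z)
  ultimately show ?thesis
    unfolding has_jderiv_def z prod.case
    by (intro exI[of _ "ft * g z + gt * f z"] exI[of _ "fx * g z + gx * f z"]
         exI[of _ "\<lambda>k. fw k * g z + gw k * f z"])
      (auto simp: f(5) g(5) algebra_simps z)
qed

lemma has_jderiv_cmult: "has_jderiv a b c f z d \<Longrightarrow> has_jderiv a b c (\<lambda>y. r * f y) z (r * d)"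
  using has_jderiv_mult[OF has_jderiv_const] by fastforce

lemma has_jderiv_minus: "has_jderiv a b c f z d \<Longrightarrow> has_jderiv a b c (\<lambda>y. - f y) z (- d)"
  using has_jderiv_cmult[of a b c f z d "-1"] by simp

lemma has_jderiv_diff:
  "has_jderiv a b c f z d \<Longrightarrow> has_jderiv a b c g z e \<Longrightarrow> has_jderiv a b c (\<lambda>y. f y - g y) z (d - e)"
  using has_jderiv_add[OF _ has_jderiv_minus] by fastforce

lemma has_jderiv_sum:
  assumes "\<And>i. i \<in> I \<Longrightarrow> has_jderiv a b c (f i) z (d i)"
  shows "has_jderiv a b c (\<lambda>y. \<Sum>i\<in>I. f i y) z (\<Sum>i\<in>I. d i)"
proof (cases "finite I")
  case True
  then show ?thesis
    using assms by (induction I) (auto intro!: has_jderiv_const has_jderiv_add)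
qed (simp add: has_jderiv_const)

lemma has_jderiv_power2:
  "has_jderiv a b c f z d \<Longrightarrow> has_jderiv a b c (\<lambda>y. (f y)\<^sup>2) z (2 * f z * d)"
  using has_jderiv_mult[of a b c f z d f d] by (simp add: power2_eq_square algebra_simps)

lemma has_jderiv_comp_coord:
  assumes "(h has_real_derivative h') (at (coord k z))"
  shows "has_jderiv a b c (\<lambda>y. h (coord k y)) z (h' * c k)"
proof -
  obtain t x w where z: "z = (t, x, w)" by (cases z) auto
  have "Sum_any (\<lambda>l. c l * (if l = k then h' else 0)) = Sum_any (\<lambda>l. if l = k then h' * c l else 0)"
    by (rule Sum_any.cong) auto
  then have "Sum_any (\<lambda>l. c l * (if l = k then h' else 0)) = h' * c k"
    by simp
  then show ?thesis
    using assms unfolding has_jderiv_def z prod.case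
    by (intro exI[of _ 0] exI[of _ "\<lambda>l. if l = k then h' else 0"]) auto
qed

text \<open>\<open>has_jderiv\<close> looks along one coordinate line at a time, so openness of D
  has to be known along these lines.\<close>

lemma open_base_slices:
  fixes D :: "'d::finite pnt set"
  assumes "open D"
  shows "open {s. base (s, x, w) \<in> D}" "open {s. base (t, s, w) \<in> D}"
    "open {s. base (t, x, w(k := s)) \<in> D}"
proof -
  have "continuous_on UNIV (\<lambda>s. base (s, x, w))" "continuous_on UNIV (\<lambda>s. base (t, s, w))"
    by (auto simp: base_def intro!: continuous_intros)
  moreover have "continuous_on UNIV (\<lambda>s. if k' = k then s else w k')" for k'
    by (cases "k' = k") (auto intro: continuous_intros)
  then have "continuous_on UNIV (\<lambda>s. base (t, x, w(k := s)))"
    unfolding base_def fun_upd_def by (auto intro!: continuous_on_Pair continuous_on_vec_lambda)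
  ultimately show "open {s. base (s, x, w) \<in> D}" "open {s. base (t, s, w) \<in> D}"
    "open {s. base (t, x, w(k := s)) \<in> D}"
    using assms by (auto simp: vimage_def dest: open_vimage)
qed

text \<open>Lets a jet function be replaced by a formula valid only over D, for instance one that
  presupposes differentiability of the components of a vector field.\<close>

lemma has_jderiv_cong_open:
  assumes "open D" "base z \<in> D" "\<And>y. base y \<in> D \<Longrightarrow> f y = g y" "has_jderiv a b c f z d"
  shows "has_jderiv a b c g z d"
proof -
  obtain t x w where z: "z = (t, x, w)" by (cases z) auto
  obtain ft fx fw where f: "((\<lambda>s. f (s, x, w)) has_real_derivative ft) (at t)"
     "((\<lambda>s. f (t, s, w)) has_real_derivative fx) (at x)"
     "\<And>k. ((\<lambda>s. f (t, x, w(k := s))) has_real_derivative fw k) (at (w k))"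
     "finite {k. fw k \<noteq> 0}" "d = a * ft + b * fx + Sum_any (\<lambda>k. c k * fw k)"
    using assms(4) by (auto simp: has_jderiv_def z)
  note op = open_base_slices[OF assms(1)]
  have "((\<lambda>s. g (s, x, w)) has_real_derivative ft) (at t)"
    by (rule has_field_derivative_transform_within_open[OF f(1) op(1)[of x w]]) (use assms z in simp_all)
  moreover have "((\<lambda>s. g (t, s, w)) has_real_derivative fx) (at x)"
    by (rule has_field_derivative_transform_within_open[OF f(2) op(2)[of t w]]) (use assms z in simp_all)
  moreover have "((\<lambda>s. g (t, x, w(k := s))) has_real_derivative fw k) (at (w k))" for k
    by (rule has_field_derivative_transform_within_open[OF f(3) op(3)[of t x w k]]) (use assms z in simp_all)
  ultimately show ?thesis
    using f(4,5) unfolding has_jderiv_def z by auto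
qed

text \<open>Chain rule: \<open>base\<close> is affine along every coordinate line, and only the
  lines of t, x and the coordinates of order zero move it.\<close>

lemma has_jderiv_base:
  fixes A :: "'d::finite pnt \<Rightarrow> real"
  assumes "A differentiable (at (base z))"
  shows "has_jderiv a b c (\<lambda>y. A (base y)) z (ddir (a, b, \<chi> \<alpha>. c (\<alpha>, 0, 0)) A (base z))"
proof -
  obtain t x w where z: "z = (t, x, w)" by (cases z) auto
  have lin: "linear (\<lambda>v. ddir v A (base z))" by (rule linear_ddir[OF assms])
  \<comment> \<open>The velocity of \<open>base\<close> when only the coordinate \<open>k\<close>
    varies.\<close>
  define e where "e k = (case k of (\<alpha>, i, j) \<Rightarrow> if i = 0 \<and> j = 0 then axis \<alpha> 1 else (0 :: real ^ 'd))"
    for k :: "'d \<times> nat \<times> nat"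
  have chain: "((\<lambda>s. A (h s)) has_real_derivative ddir h' A (base z)) (at s0)"
    if h: "(h has_derivative (\<lambda>r. r *\<^sub>R h')) (at s0)" "h s0 = base z" for h h' s0
  proof -
    have "((\<lambda>s. A (h s)) has_derivative (\<lambda>r. ddir (r *\<^sub>R h') A (base z))) (at s0)"
      using has_derivative_compose[OF h(1)] has_derivative_ddir[OF assms] h(2) by auto
    then show ?thesis
      by (simp add: has_field_derivative_def linear_cmul[OF lin] mult_commute_abs)
  qed
  have 1: "((\<lambda>s. A (base (s, x, w))) has_real_derivative ddir (1, 0, 0) A (base z)) (at t)"
    by (rule chain) (auto simp: base_def z zero_prod_def intro!: derivative_eq_intros)
  have 2: "((\<lambda>s. A (base (t, s, w))) has_real_derivative ddir (0, 1, 0) A (base z)) (at x)"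
    by (rule chain) (auto simp: base_def z zero_prod_def intro!: derivative_eq_intros)
  have 3: "((\<lambda>s. A (base (t, x, w(k := s)))) has_real_derivative ddir (0, 0, e k) A (base z)) (at (w k))" for k
  proof (rule chain)
    have "(\<lambda>s. base (t, x, w(k := s))) = (\<lambda>s. base z + (s - w k) *\<^sub>R (0, 0, e k))"
      by (rule ext) (auto simp: base_def z e_def vec_eq_iff axis_def split: prod.splits)
    then show "((\<lambda>s. base (t, x, w(k := s))) has_derivative (\<lambda>r. r *\<^sub>R (0, 0, e k))) (at (w k))"
      by (auto intro!: derivative_eq_intros)
  qed (simp add: z)
  have sub: "{k. ddir (0, 0, e k) A (base z) \<noteq> 0} \<subseteq> (\<lambda>\<alpha>. (\<alpha>, 0, 0)) ` UNIV"
  proof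
    fix k assume k: "k \<in> {k. ddir (0, 0, e k) A (base z) \<noteq> 0}"
    obtain \<alpha> i j where "k = (\<alpha>, i, j)" by (cases k) auto
    with k linear_0[OF lin] show "k \<in> range (\<lambda>\<alpha>. (\<alpha>, 0, 0))"
      by (cases "i = 0 \<and> j = 0") (auto simp: e_def zero_prod_def)
  qed
  have fin: "finite {k. ddir (0, 0, e k) A (base z) \<noteq> 0}"
    by (rule finite_subset[OF sub]) simp
  have "Sum_any (\<lambda>k. c k * ddir (0, 0, e k) A (base z))
      = (\<Sum>k\<in>(\<lambda>\<alpha>. (\<alpha>, 0, 0)) ` UNIV. c k * ddir (0, 0, e k) A (base z))"
    by (rule Sum_any.expand_superset) (use sub in auto)
  also have "\<dots> = (\<Sum>\<alpha>\<in>UNIV. c (\<alpha>, 0, 0) * ddir (0, 0, axis \<alpha> 1) A (base z))"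
    by (subst sum.reindex) (auto simp: inj_on_def e_def)
  also have "\<dots> = ddir (\<Sum>\<alpha>\<in>UNIV. c (\<alpha>, 0, 0) *\<^sub>R (0, 0, axis \<alpha> 1)) A (base z)"
    by (simp only: linear_sum[OF lin] linear_cmul[OF lin] real_scaleR_def)
  finally have s: "Sum_any (\<lambda>k. c k * ddir (0, 0, e k) A (base z))
    = ddir (\<Sum>\<alpha>\<in>UNIV. c (\<alpha>, 0, 0) *\<^sub>R (0, 0, axis \<alpha> 1)) A (base z)" .
  have "(\<chi> \<alpha>. c (\<alpha>, 0, 0)) = (\<Sum>\<alpha>\<in>UNIV. c (\<alpha>, 0, 0) *\<^sub>R axis \<alpha> (1::real))"
    by (simp add: vec_eq_iff axis_def if_distrib cong: if_cong)
  then have v: "(a, b, \<chi> \<alpha>. c (\<alpha>, 0, 0)) = a *\<^sub>R (1, 0, 0) + (b *\<^sub>R (0, 1, 0)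
      + (\<Sum>\<alpha>\<in>UNIV. c (\<alpha>, 0, 0) *\<^sub>R (0, 0, axis \<alpha> (1::real))))"
    by (simp add: prod_eq_iff fst_sum snd_sum)
  have "ddir (a, b, \<chi> \<alpha>. c (\<alpha>, 0, 0)) A (base z) = a * ddir (1, 0, 0) A (base z)
      + b * ddir (0, 1, 0) A (base z) + Sum_any (\<lambda>k. c k * ddir (0, 0, e k) A (base z))"
    unfolding v s by (simp only: linear_add[OF lin] linear_cmul[OF lin] real_scaleR_def)
  then show ?thesis
    unfolding has_jderiv_def z prod.case using 1 2 3 fin
    by (intro exI[of _ "ddir (1, 0, 0) A (base z)"] exI[of _ "ddir (0, 1, 0) A (base z)"]
        exI[of _ "\<lambda>k. ddir (0, 0, e k) A (base z)"] conjI allI) (simp_all add: z cong del: Sum_any.cong)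
qed

section \<open>Jets solving the system\<close>

text \<open>A purely set-theoretic notion: it survives total differentiation without any smoothness
  of f, so the shape of all differential consequences can be followed without computing
  them.\<close>

definition depends_on :: "('d \<times> nat \<times> nat) set \<Rightarrow> ('d jet \<Rightarrow> real) \<Rightarrow> bool" where
  "depends_on S f \<longleftrightarrow> (\<forall>t x w w'. (\<forall>k\<in>S. w k = w' k) \<longrightarrow> f (t, x, w) = f (t, x, w'))"

lemma depends_onD: "depends_on S f \<Longrightarrow> (\<And>k. k \<in> S \<Longrightarrow> w k = w' k) \<Longrightarrow> f (t, x, w) = f (t, x, w')"
  by (auto simp: depends_on_def)

lemma depends_on_upd: "depends_on S f \<Longrightarrow> k \<notin> S \<Longrightarrow> f (t, x, w(k := s)) = f (t, x, w)"
  by (rule depends_onD) auto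

lemma depends_on_mono: "depends_on S f \<Longrightarrow> S \<subseteq> T \<Longrightarrow> depends_on T f"
  unfolding depends_on_def by blast

lemma pd_w_eq_0: "depends_on S f \<Longrightarrow> k \<notin> S \<Longrightarrow> pd_w k f z = 0"
  by (cases z) (simp add: pd_w_def depends_on_upd)

text \<open>Equal slices have equal \<open>deriv\<close>, whether or not they are
  differentiable.\<close>

lemma depends_on_pd:
  assumes "depends_on S f"
  shows "depends_on S (pd_t f)" "depends_on S (pd_x f)" "depends_on S (pd_w k f)"
proof -
  have *: "f (t, x, w) = f (t, x, w')" if "\<forall>k\<in>S. w k = w' k" for t x w w'
    using assms that unfolding depends_on_def by blast
  show "depends_on S (pd_t f)" "depends_on S (pd_x f)"
    unfolding depends_on_def pd_t_def pd_x_def prod.case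
    by (intro allI impI, simp only: *)+
  show "depends_on S (pd_w k f)"
  \<comment> \<open>The partial is evaluated at \<open>w k\<close>, which agreement on S controls
    for k in S; outside S the partial vanishes.\<close>
  proof (cases "k \<in> S")
    case True
    show ?thesis
      unfolding depends_on_def pd_w_def prod.case
    proof (intro allI impI)
      fix t x and w w' :: "'a \<times> nat \<times> nat \<Rightarrow> real"
      assume *: "\<forall>k\<in>S. w k = w' k"
      then have "f (t, x, w(k := s)) = f (t, x, w'(k := s))" for s
        by (intro depends_onD[OF assms]) auto
      then show "deriv (\<lambda>s. f (t, x, w(k := s))) (w k) = deriv (\<lambda>s. f (t, x, w'(k := s))) (w' k)"
        using * True by simp
    qed
  qed (simp add: depends_on_def pd_w_eq_0[OF assms])
qed

text \<open>Common shape of \<open>Dt\<close> and \<open>Dx\<close>, so that the arguments on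
  leading coordinates are made once: \<open>P\<close> is the explicit partial and \<open>sh\<close>
  raises the order of a coordinate.\<close>

definition total :: "(('d jet \<Rightarrow> real) \<Rightarrow> 'd jet \<Rightarrow> real) \<Rightarrow> ('d \<times> nat \<times> nat \<Rightarrow> 'd \<times> nat \<times> nat)
    \<Rightarrow> ('d jet \<Rightarrow> real) \<Rightarrow> 'd jet \<Rightarrow> real" where
  "total P sh f = (\<lambda>(t, x, w). P f (t, x, w) + Sum_any (\<lambda>k. w (sh k) * pd_w k f (t, x, w)))"

lemma Dt_eq_total: "Dt = total pd_t (\<lambda>(\<alpha>, i, j). (\<alpha>, Suc i, j))"
proof (intro ext)
  fix f :: "'d jet \<Rightarrow> real" and z
  have "(\<lambda>k. w ((\<lambda>(\<alpha>, i, j). (\<alpha>, Suc i, j)) k) * pd_w k f (t, x, w)) =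
    (\<lambda>(\<alpha>, i, j). w (\<alpha>, Suc i, j) * pd_w (\<alpha>, i, j) f (t, x, w))" for t x w by auto
  then show "Dt f z = total pd_t (\<lambda>(\<alpha>, i, j). (\<alpha>, Suc i, j)) f z"
    by (cases z) (simp add: Dt_def total_def cong del: Sum_any.cong)
qed

lemma Dx_eq_total: "Dx = total pd_x (\<lambda>(\<alpha>, i, j). (\<alpha>, i, Suc j))"
proof (intro ext)
  fix f :: "'d jet \<Rightarrow> real" and z
  have "(\<lambda>k. w ((\<lambda>(\<alpha>, i, j). (\<alpha>, i, Suc j)) k) * pd_w k f (t, x, w)) =
    (\<lambda>(\<alpha>, i, j). w (\<alpha>, i, Suc j) * pd_w (\<alpha>, i, j) f (t, x, w))" for t x w by auto
  then show "Dx f z = total pd_x (\<lambda>(\<alpha>, i, j). (\<alpha>, i, Suc j)) f z"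
    by (cases z) (simp add: Dx_def total_def cong del: Sum_any.cong)
qed

lemma depends_on_total:
  assumes "depends_on S f" "P \<in> {pd_t, pd_x}"
  shows "depends_on (S \<union> sh ` S) (total P sh f)"
  unfolding depends_on_def total_def prod.case
proof (intro allI impI)
  fix t x and w w' :: "'a \<times> nat \<times> nat \<Rightarrow> real"
  assume *: "\<forall>k\<in>S \<union> sh ` S. w k = w' k"
  have "w (sh k) * pd_w k f (t, x, w) = w' (sh k) * pd_w k f (t, x, w')" for k
  proof (cases "k \<in> S")
    case True
    moreover have "pd_w k f (t, x, w) = pd_w k f (t, x, w')"
      by (rule depends_onD[OF depends_on_pd(3)[OF assms(1)]]) (use * in simp)
    ultimately show ?thesis using * by simp
  qed (simp add: pd_w_eq_0[OF assms(1)])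
  moreover have "depends_on S (P f)"
    using assms(2) depends_on_pd(1,2)[OF assms(1)] by auto
  then have "P f (t, x, w) = P f (t, x, w')"
    by (rule depends_onD) (use * in simp)
  ultimately show "P f (t, x, w) + (\<Sum>k. w (sh k) * pd_w k f (t, x, w))
      = P f (t, x, w') + (\<Sum>k. w' (sh k) * pd_w k f (t, x, w'))"
    by simp
qed

text \<open>Both functions have the same set of derivatives at x, so the equation holds also for the
  default value of \<open>deriv\<close> at a point of nondifferentiability.\<close>

lemma deriv_const_add:
  fixes f :: "real \<Rightarrow> real"
  shows "deriv (\<lambda>s. c + f s) x = deriv f x"
proof -
  have "((\<lambda>s. c + f s) has_real_derivative d) (at x) \<longleftrightarrow> (f has_real_derivative d) (at x)" for d
    using DERIV_add[OF DERIV_const[of "- c"], of "\<lambda>s. c + f s" d x UNIV]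
      DERIV_add[OF DERIV_const[of c], of f d x UNIV] by auto
  then show ?thesis by (simp add: deriv_def)
qed

text \<open>The partial along \<open>k\<close> is 1 because g ignores \<open>k\<close>; all other
  partials are those of g, and finiteness of S allows \<open>Sum_any\<close> to be split. Nothing is
  asked of g on S itself.\<close>

lemma total_coord_add:
  assumes "depends_on S g" "finite S" "k \<notin> S" "P \<in> {pd_t, pd_x}"
  shows "total P sh (\<lambda>y. coord k y + g y) = (\<lambda>y. coord (sh k) y + total P sh g y)"
proof (rule ext)
  fix z :: "'a jet"
  obtain t x w where z: "z = (t, x, w)" by (cases z) auto
  let ?f = "\<lambda>y. coord k y + g y"
  have P: "P ?f (t, x, w) = P g (t, x, w)"
    using assms(4) by (auto simp: pd_t_def pd_x_def deriv_const_add)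
  have "((\<lambda>s. s + g (t, x, w)) has_real_derivative 1) (at (w k))"
    by (auto intro!: derivative_eq_intros)
  then have "deriv (\<lambda>s. s + g (t, x, w)) (w k) = 1"
    by (rule DERIV_imp_deriv)
  then have "pd_w k ?f (t, x, w) = 1"
    by (simp add: pd_w_def depends_on_upd[OF assms(1,3)])
  moreover have "pd_w l ?f (t, x, w) = pd_w l g (t, x, w)" if "l \<noteq> k" for l
    using that by (simp add: pd_w_def deriv_const_add)
  ultimately have "(\<lambda>l. w (sh l) * pd_w l ?f (t, x, w)) =
      (\<lambda>l. (if l = k then w (sh l) else 0) + w (sh l) * pd_w l g (t, x, w))"
    using pd_w_eq_0[OF assms(1,3)] by auto
  moreover have "Sum_any (\<lambda>l. (if l = k then w (sh l) else 0) + w (sh l) * pd_w l g (t, x, w))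
    = Sum_any (\<lambda>l. if l = k then w (sh l) else 0) + Sum_any (\<lambda>l. w (sh l) * pd_w l g (t, x, w))"
  proof (rule Sum_any.distrib)
    show "finite {l. (if l = k then w (sh l) else 0) \<noteq> 0}"
      by (rule finite_subset[of _ "{k}"]) auto
    show "finite {l. w (sh l) * pd_w l g (t, x, w) \<noteq> 0}"
      by (rule finite_subset[OF _ assms(2)]) (metis (mono_tags, lifting) assms(1) pd_w_eq_0 mem_Collect_eq mult_zero_right subsetI)
  qed
  ultimately show "total P sh ?f z = coord (sh k) z + total P sh g z"
    by (simp add: total_def z P cong del: Sum_any.cong)
qed

text \<open>Solved form: in f = 0 the coordinate \<open>k\<close> is determined by finitely many
  coordinates of t-order at most \<open>n\<close>. Below, \<open>k\<close> always has t-order n +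
  1.\<close>

definition solved_for :: "nat \<Rightarrow> 'd \<times> nat \<times> nat \<Rightarrow> ('d jet \<Rightarrow> real) \<Rightarrow> bool" where
  "solved_for n k f \<longleftrightarrow> (\<exists>g S. finite S \<and> (\<forall>(\<alpha>, i, j)\<in>S. i \<le> n) \<and> depends_on S g \<and>
     f = (\<lambda>y. coord k y + g y))"

lemma solved_for_Dx:
  assumes "solved_for n (\<alpha>, Suc n, j) f"
  shows "solved_for n (\<alpha>, Suc n, Suc j) (Dx f)"
proof -
  let ?sh = "\<lambda>(\<alpha>, i, j). (\<alpha>, i, Suc j)"
  obtain g S where g: "finite S" "\<forall>(\<alpha>, i, j)\<in>S. i \<le> n" "depends_on S g"
    "f = (\<lambda>y. coord (\<alpha>, Suc n, j) y + g y)"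
    using assms by (auto simp: solved_for_def)
  have "(\<alpha>, Suc n, j) \<notin> S" using g(2) by fastforce
  then have "Dx f = (\<lambda>y. coord (\<alpha>, Suc n, Suc j) y + total pd_x ?sh g y)"
    unfolding g(4) Dx_eq_total by (subst total_coord_add[OF g(3,1)]) auto
  moreover have "depends_on (S \<union> ?sh ` S) (total pd_x ?sh g)"
    by (rule depends_on_total[OF g(3)]) simp
  moreover have "\<forall>(\<alpha>, i, j)\<in>S \<union> ?sh ` S. i \<le> n"
    using g(2) by auto
  ultimately show ?thesis
    unfolding solved_for_def using g(1) by (metis (no_types, lifting) finite_UnI finite_imageI)
qed

text \<open>\<open>Dt\<close> raises the leading t-order and the bound on the remainder together,
  while \<open>Dx\<close> raises neither, so the gap of one t-order persists in all
  consequences.\<close>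

lemma solved_for_Dt:
  assumes "solved_for n (\<alpha>, Suc n, j) f"
  shows "solved_for (Suc n) (\<alpha>, Suc (Suc n), j) (Dt f)"
proof -
  let ?sh = "\<lambda>(\<alpha>, i, j). (\<alpha>, Suc i, j)"
  obtain g S where g: "finite S" "\<forall>(\<alpha>, i, j)\<in>S. i \<le> n" "depends_on S g"
    "f = (\<lambda>y. coord (\<alpha>, Suc n, j) y + g y)"
    using assms by (auto simp: solved_for_def)
  have "(\<alpha>, Suc n, j) \<notin> S" using g(2) by fastforce
  then have "Dt f = (\<lambda>y. coord (\<alpha>, Suc (Suc n), j) y + total pd_t ?sh g y)"
    unfolding g(4) Dt_eq_total by (subst total_coord_add[OF g(3,1)]) auto
  moreover have "depends_on (S \<union> ?sh ` S) (total pd_t ?sh g)"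
    by (rule depends_on_total[OF g(3)]) simp
  moreover have "\<forall>(\<alpha>, i, j)\<in>S \<union> ?sh ` S. i \<le> Suc n"
    using g(2) by auto
  ultimately show ?thesis
    unfolding solved_for_def using g(1) by (metis (no_types, lifting) finite_UnI finite_imageI)
qed

lemma solved_for_iterate:
  assumes "solved_for 0 (\<alpha>, 1, 0) f"
  shows "solved_for i (\<alpha>, Suc i, j) ((Dt ^^ i) ((Dx ^^ j) f))"
proof -
  have "solved_for 0 (\<alpha>, 1, j) ((Dx ^^ j) f)"
    using assms by (induction j) (auto dest: solved_for_Dx)
  then show ?thesis
    by (induction i) (auto dest: solved_for_Dt)
qed

text \<open>\<open>eq_m\<close> is linear with constant coefficients, so its consequences are
  explicit. At a fixed t-order they form a two-step recursion in j for the derivatives of u, with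
  the value and the x-derivative as initial data; \<open>fill_u\<close> is its solution.\<close>

lemma Dt_Dx_eq_m:
  "(Dt ^^ i) ((Dx ^^ j) eq_m) = (\<lambda>y. coord (2, i, j) y - (coord (1, i, j) y - coord (1, i, j + 2) y))"
proof -
  have "(Dx ^^ j) eq_m = (\<lambda>y. coord (2, 0, j) y - (coord (1, 0, j) y - coord (1, 0, j + 2) y))"
  proof (induction j)
    case 0
    show ?case by (auto simp: eq_m_def coord_def Let_def numeral_2_eq_2)
  next
    case (Suc j)
    have "Dx (\<lambda>y. coord (2, 0, j) y - (coord (1, 0, j) y - coord (1, 0, j + 2) y)) (t, x, w) =
       w (2, 0, Suc j) - (w (1, 0, Suc j) - w (1, 0, Suc j + 2))" for t x and w :: "2 \<times> nat \<times> nat \<Rightarrow> real"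
      by (rule Dx_eqI, rule has_jderiv_eq_rhs, (rule has_jderiv_diff has_jderiv_coord)+) simp
    then show ?case by (auto simp: Suc)
  qed
  moreover have "(Dt ^^ i) (\<lambda>y. coord (2, 0, j) y - (coord (1, 0, j) y - coord (1, 0, j + 2) y))
    = (\<lambda>y :: 2 jet. coord (2, i, j) y - (coord (1, i, j) y - coord (1, i, j + 2) y))"
  proof (induction i)
    case (Suc i)
    have "Dt (\<lambda>y. coord (2, i, j) y - (coord (1, i, j) y - coord (1, i, j + 2) y)) (t, x, w) =
       w (2, Suc i, j) - (w (1, Suc i, j) - w (1, Suc i, j + 2))" for t x and w :: "2 \<times> nat \<times> nat \<Rightarrow> real"
      by (rule Dt_eqI, rule has_jderiv_eq_rhs, (rule has_jderiv_diff has_jderiv_coord)+) simp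
    then show ?case by (simp only: funpow.simps o_apply Suc) auto
  qed simp
  ultimately show ?thesis by simp
qed

section \<open>Formal solutions, by recursion on the t-order\<close>

fun fill_u :: "real \<Rightarrow> real \<Rightarrow> (nat \<Rightarrow> real) \<Rightarrow> nat \<Rightarrow> real" where
  "fill_u a b m 0 = a"
| "fill_u a b m (Suc 0) = b"
| "fill_u a b m (Suc (Suc j)) = fill_u a b m j - m j"

text \<open>The free coordinates of a formal solution are \<open>\<partial>\<^sub>t\<^sup>i u\<close>, \<open>\<partial>\<^sub>t\<^sup>i u\<^sub>x\<close> and \<open>\<partial>\<^sub>x\<^sup>j m\<close>; the
  others are determined by recursion on the \<open>t\<close>-order.\<close>
lemma formal_solution_exists:
  fixes a b c :: "nat \<Rightarrow> real"
  assumes F: "solved_for 0 (2, 1, 0) F"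
  obtains w :: "2 \<times> nat \<times> nat \<Rightarrow> real"
  where "\<And>i. w (1, i, 0) = a i" "\<And>i. w (1, i, 1) = b i" "\<And>j. w (2, 0, j) = c j"
    "\<And>i j. (Dt ^^ i) ((Dx ^^ j) eq_m) (t, x, w) = 0" "\<And>i j. (Dt ^^ i) ((Dx ^^ j) F) (t, x, w) = 0"
proof -
  \<comment> \<open>What remains of a consequence of F without its leading coordinate; it involves
    t-orders up to i only.\<close>
  define G where "G i j y = (Dt ^^ i) ((Dx ^^ j) F) y - coord (2, Suc i, j) y" for i j y
  have G: "depends_on {(\<alpha>, i', j'). i' \<le> i} (G i j)" for i j
  proof -
    obtain g S where g: "finite S" "\<forall>(\<alpha>, i', j)\<in>S. i' \<le> i" "depends_on S g"
      "(Dt ^^ i) ((Dx ^^ j) F) = (\<lambda>y. coord (2, Suc i, j) y + g y)"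
      using solved_for_iterate[OF F, of i j] by (auto simp: solved_for_def)
    then have "G i j = g" by (auto simp: G_def)
    moreover have "S \<subseteq> {(\<alpha>, i', j'). i' \<le> i}" using g(2) by auto
    ultimately show ?thesis using depends_on_mono[OF g(3)] by simp
  qed
  define ext where "ext n m v = (\<lambda>(\<alpha> :: 2, i, j). if i \<noteq> n then v (\<alpha>, i, j)
      else if \<alpha> = 2 then m j else fill_u (a n) (b n) m j)" for n :: nat and m and v :: "2 \<times> nat \<times> nat \<Rightarrow> real"
  \<comment> \<open>Stage n + 1 writes the row of t-order n + 1 and leaves the others alone, so
    \<open>lev n\<close> is final in the rows up to n and the diagonal \<open>w\<close> collects all
    final rows. The m-row is chosen as \<open>- G n j\<close> to annul the consequences of
    F.\<close>
  define lev where "lev = rec_nat (ext 0 c (\<lambda>_. 0)) (\<lambda>n v. ext (Suc n) (\<lambda>j. - G n j (t, x, v)) v)"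
  define w where "w = (\<lambda>(\<alpha>, i, j). lev i (\<alpha>, i, j))"
  have lev: "lev n (\<alpha>, i, j) = w (\<alpha>, i, j)" if "i \<le> n" for n \<alpha> i j
    using that
  proof (induction n)
    case (Suc n)
    then show ?case by (cases "i = Suc n") (auto simp: w_def lev_def ext_def)
  qed (simp add: w_def)
  define mm where "mm i = (\<lambda>j. w (2, i, j))" for i
  have levS: "lev n = ext n (mm n) (case n of 0 \<Rightarrow> \<lambda>_. 0 | Suc k \<Rightarrow> lev k)" for n
    by (cases n) (auto simp: mm_def w_def lev_def ext_def fun_eq_iff)
  have u: "w (1, i, j) = fill_u (a i) (b i) (mm i) j" for i j
    unfolding w_def prod.case by (subst levS) (simp add: ext_def)
  have m: "w (2, Suc i, j) = - G i j (t, x, w)" for i j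
  proof -
    have "w (2, Suc i, j) = - G i j (t, x, lev i)"
      by (simp add: w_def lev_def ext_def)
    also have "G i j (t, x, lev i) = G i j (t, x, w)"
      by (rule depends_onD[OF G[of i j]]) (auto simp: lev)
    finally show ?thesis .
  qed
  show ?thesis
  proof
    show "w (2, 0, j) = c j" for j by (simp add: w_def lev_def ext_def)
    show "(Dt ^^ i) ((Dx ^^ j) eq_m) (t, x, w) = 0" for i j
      by (simp add: Dt_Dx_eq_m u mm_def)
    show "(Dt ^^ i) ((Dx ^^ j) F) (t, x, w) = 0" for i j
      using m[of i j] by (simp add: G_def)
  qed (simp_all add: u)
qed

lemma solved_for_eq_mt: "solved_for 0 (2, 1, 0) (eq_mt p)"
proof -
  define g where "g y = eq_mt p y - coord (2, 1, 0) y" for y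
  have "depends_on {(1, 0, 0), (1, 0, 1), (2, 0, 0), (2, 0, 1)} g"
    by (auto simp: depends_on_def g_def eq_mt_def Let_def)
  moreover have "eq_mt p = (\<lambda>y. coord (2, 1, 0) y + g y)"
    by (auto simp: g_def)
  ultimately show ?thesis
    unfolding solved_for_def
    by (intro exI[of _ g] exI[of _ "{(1, 0, 0), (1, 0, 1), (2, 0, 0), (2, 0, 1)}"]) auto
qed

section \<open>Prolongation\<close>

lemma has_jderiv_fst: "has_jderiv a b c fst z a"
proof (cases z)
  case (fields t x w)
  show ?thesis
    unfolding has_jderiv_def fields prod.case
    by (intro exI[of _ 1] exI[of _ 0] exI[of _ "\<lambda>_. 0"]) auto
qed

lemmas has_jderiv_intros = has_jderiv_const has_jderiv_coord has_jderiv_fst has_jderiv_add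
  has_jderiv_diff has_jderiv_minus has_jderiv_power2 has_jderiv_cmult has_jderiv_mult

lemma smooth_on_components:
  fixes X :: "'d::finite vfield"
  assumes "open D" "smooth_on D X"
  shows "smooth_on D (\<lambda>y. fst (X y))" "smooth_on D (\<lambda>y. fst (snd (X y)))"
    "smooth_on D (\<lambda>y. snd (snd (X y)) $ \<alpha>)"
proof -
  note comp = smooth_on_bounded_linear_comp[OF assms(1) _ assms(2)]
  show "smooth_on D (\<lambda>y. fst (X y))" "smooth_on D (\<lambda>y. fst (snd (X y)))"
    by (rule comp, intro bounded_linear_intros)+
  show "smooth_on D (\<lambda>y. snd (snd (X y)) $ \<alpha>)"
    by (rule comp[of "\<lambda>v. snd (snd v) $ \<alpha>"], rule bounded_linear_compose[OF bounded_linear_vec_nth])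
      (intro bounded_linear_intros)
qed

text \<open>Over these directions the total derivatives \<open>Dx\<close> and \<open>Dt\<close> of A
  (base z) are ordinary directional derivatives of A.\<close>

abbreviation x_dir :: "('d::finite \<times> nat \<times> nat \<Rightarrow> real) \<Rightarrow> 'd pnt" where
  "x_dir w \<equiv> (0, 1, \<chi> \<alpha>. w (\<alpha>, 0, 1))"

abbreviation t_dir :: "('d::finite \<times> nat \<times> nat \<Rightarrow> real) \<Rightarrow> 'd pnt" where
  "t_dir w \<equiv> (1, 0, \<chi> \<alpha>. w (\<alpha>, 1, 0))"

lemma has_jderiv_characteristic:
  fixes X :: "'d::finite vfield" and c :: "'d \<times> nat \<times> nat \<Rightarrow> real"
  fixes a b :: real
  assumes "open D" "smooth_on D X" "base z \<in> D"
  defines "d \<equiv> \<lambda>A. ddir (a, b, \<chi> \<alpha>. c (\<alpha>, 0, 0)) A (base z)"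
  shows "has_jderiv a b c (characteristic X \<alpha>) z (d (\<lambda>y. snd (snd (X y)) $ \<alpha>)
      - (d (\<lambda>y. fst (X y)) * coord (\<alpha>, 1, 0) z + vf_tau X z * c (\<alpha>, 1, 0))
      - (d (\<lambda>y. fst (snd (X y))) * coord (\<alpha>, 0, 1) z + vf_xi X z * c (\<alpha>, 0, 1)))"
proof -
  note diff = smooth_on_components[OF assms(1,2), THEN smooth_on_differentiable, OF assms(3)]
  have "characteristic X \<alpha> = (\<lambda>y. snd (snd (X (base y))) $ \<alpha>
      - fst (X (base y)) * coord (\<alpha>, 1, 0) y - fst (snd (X (base y))) * coord (\<alpha>, 0, 1) y)"
    by (auto simp: characteristic_def vf_eta_def vf_tau_def vf_xi_def)
  then show ?thesis
    unfolding d_def vf_tau_def vf_xi_def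
    by (simp only:) (intro has_jderiv_diff has_jderiv_mult has_jderiv_coord has_jderiv_base diff)
qed

lemma prol_coeff_00: "prol_coeff X (\<alpha>, 0, 0) z = vf_eta X \<alpha> z"
  by (cases z) (simp add: prol_coeff_def characteristic_def)

lemma Dx_characteristic:
  fixes X :: "'d::finite vfield"
  assumes "open D" "smooth_on D X" "base (t, x, w) \<in> D"
  defines "d \<equiv> \<lambda>A. ddir (x_dir w) A (base (t, x, w))"
  shows "Dx (characteristic X \<alpha>) (t, x, w) = d (\<lambda>y. snd (snd (X y)) $ \<alpha>)
      - (d (\<lambda>y. fst (X y)) * w (\<alpha>, 1, 0) + vf_tau X (t, x, w) * w (\<alpha>, 1, 1))
      - (d (\<lambda>y. fst (snd (X y))) * w (\<alpha>, 0, 1) + vf_xi X (t, x, w) * w (\<alpha>, 0, 2))"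
  unfolding d_def
  by (rule Dx_eqI, rule has_jderiv_eq_rhs[OF has_jderiv_characteristic[OF assms(1-3)]])
    (simp add: numeral_2_eq_2)

text \<open>The second-order terms produced by \<open>Dx\<close> of the characteristic cancel
  against the two terms that \<open>prol_coeff\<close> adds.\<close>

lemma prol_coeff_x:
  fixes X :: "'d::finite vfield"
  assumes "open D" "smooth_on D X" "base (t, x, w) \<in> D"
  defines "d \<equiv> \<lambda>A. ddir (x_dir w) A (base (t, x, w))"
  shows "prol_coeff X (\<alpha>, 0, 1) (t, x, w) = d (\<lambda>y. snd (snd (X y)) $ \<alpha>)
      - d (\<lambda>y. fst (X y)) * w (\<alpha>, 1, 0) - d (\<lambda>y. fst (snd (X y))) * w (\<alpha>, 0, 1)"
  using Dx_characteristic[OF assms(1-3), of \<alpha>]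
  by (simp add: prol_coeff_def d_def numeral_2_eq_2)

lemma prol_coeff_t:
  fixes X :: "'d::finite vfield"
  assumes "open D" "smooth_on D X" "base (t, x, w) \<in> D"
  defines "d \<equiv> \<lambda>A. ddir (t_dir w) A (base (t, x, w))"
  shows "prol_coeff X (\<alpha>, 1, 0) (t, x, w) = d (\<lambda>y. snd (snd (X y)) $ \<alpha>)
      - d (\<lambda>y. fst (X y)) * w (\<alpha>, 1, 0) - d (\<lambda>y. fst (snd (X y))) * w (\<alpha>, 0, 1)"
proof -
  have "Dt (characteristic X \<alpha>) (t, x, w) = d (\<lambda>y. snd (snd (X y)) $ \<alpha>)
      - (d (\<lambda>y. fst (X y)) * w (\<alpha>, 1, 0) + vf_tau X (t, x, w) * w (\<alpha>, 2, 0))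
      - (d (\<lambda>y. fst (snd (X y))) * w (\<alpha>, 0, 1) + vf_xi X (t, x, w) * w (\<alpha>, 1, 1))"
    unfolding d_def
    by (rule Dt_eqI, rule has_jderiv_eq_rhs[OF has_jderiv_characteristic[OF assms(1-3)]])
      (simp add: numeral_2_eq_2)
  then show ?thesis
    by (simp add: prol_coeff_def numeral_2_eq_2)
qed

text \<open>This is \<open>Dx\<close> applied twice to A (base z). The mixed derivatives are
  recorded in both orders, because their equality is not established here.\<close>

definition xx_deriv :: "('d::finite pnt \<Rightarrow> real) \<Rightarrow> 'd jet \<Rightarrow> real" where
  "xx_deriv A = (\<lambda>(t, x, w). ddir (x_dir w) (ddir (0, 1, 0) A) (base (t, x, w))
    + (\<Sum>\<alpha>\<in>UNIV. w (\<alpha>, 0, 2) * ddir (0, 0, axis \<alpha> 1) A (base (t, x, w))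
        + w (\<alpha>, 0, 1) * ddir (x_dir w) (ddir (0, 0, axis \<alpha> 1) A) (base (t, x, w))))"

lemma ddir_split:
  fixes A :: "'d::finite pnt \<Rightarrow> real"
  assumes "A differentiable (at y)"
  shows "ddir (a, b, v) A y = a * ddir (1, 0, 0) A y + b * ddir (0, 1, 0) A y
    + (\<Sum>\<alpha>\<in>UNIV. v $ \<alpha> * ddir (0, 0, axis \<alpha> 1) A y)"
proof -
  note lin = linear_ddir[OF assms]
  have "v = (\<Sum>\<alpha>\<in>UNIV. v $ \<alpha> *\<^sub>R axis \<alpha> (1::real))"
    by (simp add: vec_eq_iff axis_def if_distrib cong: if_cong)
  then have "(a, b, v) = a *\<^sub>R (1, 0, 0) + b *\<^sub>R (0, 1, 0)
      + (\<Sum>\<alpha>\<in>UNIV. v $ \<alpha> *\<^sub>R (0, 0, axis \<alpha> (1::real)))"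
    by (simp add: prod_eq_iff fst_sum snd_sum)
  then show ?thesis
    by (simp only: linear_add[OF lin] linear_cmul[OF lin] linear_sum[OF lin] real_scaleR_def)
qed

text \<open>The direction of differentiation itself varies with the jet. Split into fixed directions
  with coordinate functions as coefficients, the expression becomes accessible to the product
  rule.\<close>

lemma has_jderiv_x_dir:
  fixes A :: "'d::finite pnt \<Rightarrow> real"
  assumes "open D" "smooth_on D A" "base (t, x, w) \<in> D"
  shows "has_jderiv 0 1 (\<lambda>(\<alpha>, i, j). w (\<alpha>, i, Suc j))
    (\<lambda>y. ddir (0, 1, \<chi> \<alpha>. coord (\<alpha>, 0, 1) y) A (base y)) (t, x, w) (xx_deriv A (t, x, w))"
proof (rule has_jderiv_cong_open[OF assms(1,3)])
  show "ddir (0, 1, 0) A (base y) + (\<Sum>\<alpha>\<in>UNIV. coord (\<alpha>, 0, 1) y * ddir (0, 0, axis \<alpha> 1) A (base y))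
    = ddir (0, 1, \<chi> \<alpha>. coord (\<alpha>, 0, 1) y) A (base y)" if "base y \<in> D" for y
    by (subst ddir_split[OF smooth_on_differentiable[OF assms(2) that]]) simp
  show "has_jderiv 0 1 (\<lambda>(\<alpha>, i, j). w (\<alpha>, i, Suc j))
    (\<lambda>y. ddir (0, 1, 0) A (base y) + (\<Sum>\<alpha>\<in>UNIV. coord (\<alpha>, 0, 1) y * ddir (0, 0, axis \<alpha> 1) A (base y)))
    (t, x, w) (xx_deriv A (t, x, w))"
    by (rule has_jderiv_eq_rhs, (rule has_jderiv_add has_jderiv_sum has_jderiv_mult has_jderiv_coord
          has_jderiv_base smooth_on_differentiable[OF smooth_on_ddir[OF assms(2)] assms(3)])+)
      (simp add: xx_deriv_def numeral_2_eq_2)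
qed

text \<open>The factors 2 come from the product rule for the second \<open>Dx\<close>; the
  third-order terms cancel as in \<open>prol_coeff_x\<close>.\<close>

lemma prol_coeff_xx:
  fixes X :: "'d::finite vfield"
  assumes "open D" "smooth_on D X" "base (t, x, w) \<in> D"
  defines "d \<equiv> \<lambda>A. ddir (x_dir w) A (base (t, x, w))"
  shows "prol_coeff X (\<alpha>, 0, 2) (t, x, w) = xx_deriv (\<lambda>y. snd (snd (X y)) $ \<alpha>) (t, x, w)
      - xx_deriv (\<lambda>y. fst (X y)) (t, x, w) * w (\<alpha>, 1, 0) - 2 * d (\<lambda>y. fst (X y)) * w (\<alpha>, 1, 1)
      - xx_deriv (\<lambda>y. fst (snd (X y))) (t, x, w) * w (\<alpha>, 0, 1)
      - 2 * d (\<lambda>y. fst (snd (X y))) * w (\<alpha>, 0, 2)"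
proof -
  note comps = smooth_on_components[OF assms(1,2)]
  note diff = comps[THEN smooth_on_differentiable, OF assms(3)]
  let ?f = "\<lambda>y. ddir (0, 1, \<chi> \<alpha>. coord (\<alpha>, 0, 1) y) (\<lambda>y. snd (snd (X y)) $ \<alpha>) (base y)
     - (ddir (0, 1, \<chi> \<alpha>. coord (\<alpha>, 0, 1) y) (\<lambda>y. fst (X y)) (base y) * coord (\<alpha>, 1, 0) y
         + fst (X (base y)) * coord (\<alpha>, 1, 1) y)
      - (ddir (0, 1, \<chi> \<alpha>. coord (\<alpha>, 0, 1) y) (\<lambda>y. fst (snd (X y))) (base y) * coord (\<alpha>, 0, 1) y
         + fst (snd (X (base y))) * coord (\<alpha>, 0, 2) y)"
  have "Dx (Dx (characteristic X \<alpha>)) (t, x, w) = xx_deriv (\<lambda>y. snd (snd (X y)) $ \<alpha>) (t, x, w)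
      - (xx_deriv (\<lambda>y. fst (X y)) (t, x, w) * w (\<alpha>, 1, 0) + d (\<lambda>y. fst (X y)) * w (\<alpha>, 1, 1)
        + (d (\<lambda>y. fst (X y)) * w (\<alpha>, 1, 1) + vf_tau X (t, x, w) * w (\<alpha>, 1, 2)))
      - (xx_deriv (\<lambda>y. fst (snd (X y))) (t, x, w) * w (\<alpha>, 0, 1) + d (\<lambda>y. fst (snd (X y))) * w (\<alpha>, 0, 2)
        + (d (\<lambda>y. fst (snd (X y))) * w (\<alpha>, 0, 2) + vf_xi X (t, x, w) * w (\<alpha>, 0, 3)))"
  proof (rule Dx_eqI, rule has_jderiv_cong_open[OF assms(1,3)])
    show "?f y = Dx (characteristic X \<alpha>) y" if "base y \<in> D" for y
      using Dx_characteristic[OF assms(1,2), of "fst y" "fst (snd y)" "snd (snd y)" \<alpha>] that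
      by (simp add: coord_def vf_tau_def vf_xi_def)
  next
    show "has_jderiv 0 1 (\<lambda>(\<alpha>, i, j). w (\<alpha>, i, Suc j)) ?f (t, x, w) (xx_deriv (\<lambda>y. snd (snd (X y)) $ \<alpha>) (t, x, w)
      - (xx_deriv (\<lambda>y. fst (X y)) (t, x, w) * w (\<alpha>, 1, 0) + d (\<lambda>y. fst (X y)) * w (\<alpha>, 1, 1)
        + (d (\<lambda>y. fst (X y)) * w (\<alpha>, 1, 1) + vf_tau X (t, x, w) * w (\<alpha>, 1, 2)))
      - (xx_deriv (\<lambda>y. fst (snd (X y))) (t, x, w) * w (\<alpha>, 0, 1) + d (\<lambda>y. fst (snd (X y))) * w (\<alpha>, 0, 2)
        + (d (\<lambda>y. fst (snd (X y))) * w (\<alpha>, 0, 2) + vf_xi X (t, x, w) * w (\<alpha>, 0, 3))))"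
      by (rule has_jderiv_eq_rhs, (rule has_jderiv_add has_jderiv_diff has_jderiv_mult has_jderiv_coord
          has_jderiv_x_dir[OF assms(1) _ assms(3)] comps has_jderiv_base diff)+)
        (simp add: d_def vf_tau_def vf_xi_def numeral_2_eq_2 numeral_3_eq_3)
  qed
  then show ?thesis
    by (simp add: prol_coeff_def numeral_2_eq_2 numeral_3_eq_3 algebra_simps)
qed

text \<open>The characteristic is c q - (b - c p t) q_t - a q_x. Each \<open>Dt\<close> that meets
  the explicit t contributes one more c p to the coefficient, which gives the weight 1 + i p;
  \<open>Dx\<close> contributes nothing of this kind.\<close>

lemma prol_coeff_scaling:
  fixes X :: "'d::finite vfield"
  assumes "open D" "\<And>t x q. (t, x, q) \<in> D \<Longrightarrow> X (t, x, q) = (b - c * p * t, a, c *\<^sub>R q)"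
    and "base z \<in> D"
  shows "prol_coeff X (\<alpha>, i, j) z = c * (1 + real i * p) * coord (\<alpha>, i, j) z"
proof -
  \<comment> \<open>Closed form of the i-th \<open>Dt\<close> of the j-th \<open>Dx\<close> of the
    characteristic.\<close>
  let ?f = "\<lambda>i j y. c * (1 + real i * p) * coord (\<alpha>, i, j) y
      - (b - c * p * fst y) * coord (\<alpha>, Suc i, j) y - a * coord (\<alpha>, i, Suc j) y"
  have tau: "vf_tau X y = b - c * p * fst y" and xi: "vf_xi X y = a"
    and eta: "vf_eta X \<alpha> y = c * coord (\<alpha>, 0, 0) y" if "base y \<in> D" for y
    using that assms(2)[of "fst y" "fst (snd y)" "\<chi> \<alpha>. snd (snd y) (\<alpha>, 0, 0)"]
    by (cases y; simp add: vf_tau_def vf_xi_def vf_eta_def base_def)+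
  have x: "(Dx ^^ j) (characteristic X \<alpha>) y = ?f 0 j y" if "base y \<in> D" for y j
    using that
  proof (induction j arbitrary: y)
    case 0
    then show ?case by (cases y) (simp add: characteristic_def tau xi eta)
  next
    case (Suc j)
    obtain t x w where y: "y = (t, x, w)" by (cases y) auto
    have "Dx ((Dx ^^ j) (characteristic X \<alpha>)) (t, x, w) = ?f 0 (Suc j) (t, x, w)"
    proof (rule Dx_eqI, rule has_jderiv_cong_open[OF assms(1)])
      show "has_jderiv 0 1 (\<lambda>(\<alpha>, i, j). w (\<alpha>, i, Suc j)) (?f 0 j) (t, x, w) (?f 0 (Suc j) (t, x, w))"
        by (rule has_jderiv_eq_rhs, (rule has_jderiv_intros)+) simp
    qed (use Suc y in auto)
    then show ?case by (simp add: y)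
  qed
  have "(Dt ^^ i) ((Dx ^^ j) (characteristic X \<alpha>)) y = ?f i j y" if "base y \<in> D" for y
    using that
  proof (induction i arbitrary: y)
    case (Suc i)
    obtain t x w where y: "y = (t, x, w)" by (cases y) auto
    have "Dt ((Dt ^^ i) ((Dx ^^ j) (characteristic X \<alpha>))) (t, x, w) = ?f (Suc i) j (t, x, w)"
    proof (rule Dt_eqI, rule has_jderiv_cong_open[OF assms(1)])
      show "has_jderiv 1 0 (\<lambda>(\<alpha>, i, j). w (\<alpha>, Suc i, j)) (?f i j) (t, x, w) (?f (Suc i) j (t, x, w))"
        by (rule has_jderiv_eq_rhs, (rule has_jderiv_intros)+) (simp add: algebra_simps)
    qed (use Suc y in auto)
    then show ?case by (simp add: y)
  qed (simp add: x)
  from this[OF assms(3)] show ?thesis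
    by (cases z) (use tau[OF assms(3)] xi[OF assms(3)] in \<open>simp add: prol_coeff_def\<close>)
qed

section \<open>The equations\<close>

text \<open>At u = 0 the exponent is a nonnegative integer; for a = 0 the factor a removes the value
  of \<open>rpow\<close> at a negative exponent.\<close>

lemma DERIV_rpow:
  assumes "u > 0 \<or> a \<in> \<int> \<and> (u \<noteq> 0 \<or> a \<ge> 0)"
  shows "((\<lambda>s. rpow s a) has_real_derivative a * rpow u (a - 1)) (at u)"
proof (cases "a \<in> \<int>")
  case True
  then obtain n where n: "a = of_int n" by (auto elim: Ints_cases)
  then have "a - 1 = of_int (n - 1)" by simp
  then have *: "rpow s a = s powi n" "rpow s (a - 1) = s powi (n - 1)" for s
    unfolding rpow_def n by (simp_all del: of_int_diff)
  show ?thesis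
  proof (cases "u = 0")
    case False
    then show ?thesis unfolding *
      by (auto simp: n intro!: derivative_eq_intros)
  next
    case u: True
    then obtain k where k: "n = int k" using assms n by (auto elim: nonneg_int_cases)
    show ?thesis
    proof (cases k)
      case 0
      then show ?thesis unfolding * by (simp add: n k)
    next
      case (Suc l)
      have "(\<lambda>s. s powi n) = (\<lambda>s::real. s ^ Suc l)" "u powi (n - 1) = u ^ l" "a = real (Suc l)"
        using k Suc n by (auto simp: power_int_def nat_add_distrib)
      then show ?thesis unfolding *
        using DERIV_pow[of "Suc l" u] by simp
    qed
  qed
next
  case False
  then have "u > 0" "a - 1 \<notin> \<int>" using assms by (auto dest: Ints_add[of "a - 1" 1])
  then show ?thesis
    using False by (auto simp: rpow_def intro!: has_real_derivative_powr)
qed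

text \<open>The factor a cannot be cancelled: for a = 0 and u = 0 the remaining equation would read
  0 = 1.\<close>

lemma mult_rpow:
  assumes "u > 0 \<or> a \<in> \<int> \<and> (u \<noteq> 0 \<or> a \<ge> 0)"
  shows "a * rpow u (a - 1) * u = a * rpow u a"
proof (cases "a \<in> \<int>")
  case True
  then obtain n where n: "a = of_int n" by (auto elim: Ints_cases)
  then have "a - 1 = of_int (n - 1)" by simp
  then have *: "rpow u a = u powi n" "rpow u (a - 1) = u powi (n - 1)"
    unfolding rpow_def n by (simp_all del: of_int_diff)
  show ?thesis
  proof (cases "u = 0")
    case False
    then show ?thesis unfolding * by (simp add: power_int_diff)
  next
    case u: True
    then show ?thesis unfolding * using assms n by (cases "n = 0") auto
  qed
next
  case False
  then have "u > 0" "a - 1 \<notin> \<int>" using assms by (auto dest: Ints_add[of "a - 1" 1])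
  then show ?thesis
    using False by (simp add: rpow_def powr_diff)
qed

lemma rpow_nonzero: "u \<noteq> 0 \<Longrightarrow> u > 0 \<or> a \<in> \<int> \<Longrightarrow> rpow u a \<noteq> 0"
  by (auto simp: rpow_def)

context
  fixes p u :: real
  assumes u: "u \<in> admissible p"
begin

text \<open>A positive integer p is 1 or at least 2, so p - 1 and p - 2 are nonnegative at u = 0
  except for p - 2 = -1. This exception is the alternative p = 1, where the coefficient p (p - 1)
  vanishes.\<close>

lemma admissible_exponents:
  "u > 0 \<or> p \<in> \<int> \<and> (u \<noteq> 0 \<or> p \<ge> 0)"
  "u > 0 \<or> p - 1 \<in> \<int> \<and> (u \<noteq> 0 \<or> p - 1 \<ge> 0)"
  "p = 1 \<or> u > 0 \<or> p - 2 \<in> \<int> \<and> (u \<noteq> 0 \<or> p - 2 \<ge> 0)"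
proof -
  have *: "u > 0 \<or> p \<in> \<int> \<and> (u \<noteq> 0 \<or> p > 0)"
    using u by (auto simp: admissible_def)
  have "p \<ge> 1 \<and> (p = 1 \<or> p \<ge> 2)" if "p \<in> \<int>" "p > 0"
  proof -
    from \<open>p \<in> \<int>\<close> obtain n where "p = of_int n" by (auto elim: Ints_cases)
    with \<open>p > 0\<close> show ?thesis by auto
  qed
  with * show "u > 0 \<or> p \<in> \<int> \<and> (u \<noteq> 0 \<or> p \<ge> 0)"
    "u > 0 \<or> p - 1 \<in> \<int> \<and> (u \<noteq> 0 \<or> p - 1 \<ge> 0)"
    "p = 1 \<or> u > 0 \<or> p - 2 \<in> \<int> \<and> (u \<noteq> 0 \<or> p - 2 \<ge> 0)"
    by auto
qed

lemma mult_rpow_p: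
  "p * rpow u (p - 1) * u = p * rpow u p"
  "(p - 1) * rpow u (p - 2) * u = (p - 1) * rpow u (p - 1)"
  "(p - 1) * ((p - 2) * rpow u (p - 3) * u) = (p - 1) * ((p - 2) * rpow u (p - 2))"
proof -
  have e: "p - 1 - 1 = p - 2" "p - 2 - 1 = p - 3" by simp_all
  show "p * rpow u (p - 1) * u = p * rpow u p"
    "(p - 1) * rpow u (p - 2) * u = (p - 1) * rpow u (p - 1)"
    using mult_rpow[OF admissible_exponents(1)] mult_rpow[OF admissible_exponents(2)]
    by (simp_all only: e)
  show "(p - 1) * ((p - 2) * rpow u (p - 3) * u) = (p - 1) * ((p - 2) * rpow u (p - 2))"
  proof (cases "p = 1")
    case False
    then have "(p - 2) * rpow u (p - 3) * u = (p - 2) * rpow u (p - 2)"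
      using mult_rpow[of u "p - 2", unfolded e] admissible_exponents(3) by blast
    then show ?thesis by simp
  qed simp
qed

text \<open>The powers keep their coefficients: for p = 1 the function s^(-1) has no derivative at
  0, but its product with p (p - 1) is the zero function.\<close>

lemma DERIV_rpow_p:
  "((\<lambda>s. rpow s p) has_real_derivative p * rpow u (p - 1)) (at u)"
  "((\<lambda>s. k * p * rpow s (p - 1)) has_real_derivative k * p * (p - 1) * rpow u (p - 2)) (at u)"
  "((\<lambda>s. k * p * (p - 1) * rpow s (p - 2)) has_real_derivative k * p * (p - 1) * (p - 2) * rpow u (p - 3)) (at u)"
proof -
  show "((\<lambda>s. rpow s p) has_real_derivative p * rpow u (p - 1)) (at u)"
    by (rule DERIV_rpow[OF admissible_exponents(1)])
  show "((\<lambda>s. k * p * rpow s (p - 1)) has_real_derivative k * p * (p - 1) * rpow u (p - 2)) (at u)"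
    using DERIV_cmult[OF DERIV_rpow[OF admissible_exponents(2)], of "k * p"]
    by (simp add: algebra_simps)
  show "((\<lambda>s. k * p * (p - 1) * rpow s (p - 2)) has_real_derivative k * p * (p - 1) * (p - 2) * rpow u (p - 3)) (at u)"
  proof (cases "p = 1")
    case False
    then show ?thesis
      using DERIV_cmult[OF DERIV_rpow[of u "p - 2"], of "k * p * (p - 1)"] admissible_exponents(3)
      by (simp add: algebra_simps)
  qed simp
qed

end

section \<open>Linearisation of the equations\<close>

lemma has_jderiv_rpow:
  assumes "coord k z \<in> admissible p"
  shows "has_jderiv a b c (\<lambda>y. rpow (coord k y) p) z (p * rpow (coord k z) (p - 1) * c k)"
    "has_jderiv a b c (\<lambda>y. r * p * rpow (coord k y) (p - 1)) z
      (r * p * (p - 1) * rpow (coord k z) (p - 2) * c k)"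
    "has_jderiv a b c (\<lambda>y. r * p * (p - 1) * rpow (coord k y) (p - 2)) z
      (r * p * (p - 1) * (p - 2) * rpow (coord k z) (p - 3) * c k)"
  by (rule has_jderiv_comp_coord DERIV_rpow_p assms)+

lemma has_jderiv_power3:
  "has_jderiv a b c f z d \<Longrightarrow> has_jderiv a b c (\<lambda>y. f y ^ 3) z (3 * (f z)\<^sup>2 * d)"
  using has_jderiv_mult[OF has_jderiv_power2, of a b c f z d f d]
  by (simp add: power3_eq_cube power2_eq_square algebra_simps)

lemma has_jderiv_eq_m:
  "has_jderiv a b c eq_m z (c (2, 0, 0) - (c (1, 0, 0) - c (1, 0, 2)))"
proof -
  have *: "eq_m = (\<lambda>y. coord (2, 0, 0) y - (coord (1, 0, 0) y - coord (1, 0, 2) y))"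
    by (auto simp: eq_m_def Let_def)
  show ?thesis
    unfolding * by (intro has_jderiv_diff has_jderiv_coord)
qed

text \<open>In the last summand, 2 u u_x and u^2 - 3 u_x^2 are the partials of (u^2 - u_x^2) u_x
  with respect to u and u_x.\<close>

lemma has_jderiv_eq_mt:
  fixes w :: "2 \<times> nat \<times> nat \<Rightarrow> real"
  defines "u \<equiv> w (1, 0, 0)" and "u_x \<equiv> w (1, 0, 1)" and "m \<equiv> w (2, 0, 0)" and "m_x \<equiv> w (2, 0, 1)"
  assumes "u \<in> admissible p"
  shows "has_jderiv a b c (eq_mt p) (t, x, w) (c (2, 1, 0)
    - (2 * p * (p - 1) * rpow u (p - 2) * c (1, 0, 0) * u_x * m
       + 2 * p * rpow u (p - 1) * (c (1, 0, 1) * m + u_x * c (2, 0, 0))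
       + p * rpow u (p - 1) * c (1, 0, 0) * m_x + rpow u p * c (2, 0, 1)
       + 1/2 * p * (p - 1) * (p - 2) * rpow u (p - 3) * c (1, 0, 0) * (u\<^sup>2 - u_x\<^sup>2) * u_x
       + 1/2 * p * (p - 1) * rpow u (p - 2)
          * (2 * u * c (1, 0, 0) * u_x + (u\<^sup>2 - 3 * u_x\<^sup>2) * c (1, 0, 1))))"
proof -
  have ad: "coord (1, 0, 0) (t, x, w) \<in> admissible p"
    using assms by simp
  have *: "eq_mt p = (\<lambda>y. coord (2, 1, 0) y
      - (2 * p * rpow (coord (1, 0, 0) y) (p - 1) * coord (1, 0, 1) y * coord (2, 0, 0) y
         + rpow (coord (1, 0, 0) y) p * coord (2, 0, 1) y
         + 1/2 * p * (p - 1) * rpow (coord (1, 0, 0) y) (p - 2)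
           * ((coord (1, 0, 0) y)\<^sup>2 - (coord (1, 0, 1) y)\<^sup>2) * coord (1, 0, 1) y))"
    by (auto simp: eq_mt_def Let_def)
  show ?thesis
    unfolding *
    by (rule has_jderiv_eq_rhs, (rule has_jderiv_add has_jderiv_diff has_jderiv_rpow[OF ad]
        has_jderiv_coord has_jderiv_power2 has_jderiv_mult)+)
      (simp add: u_def u_x_def m_def m_x_def field_simps power2_eq_square)
qed

lemma has_jderiv_eq_u:
  fixes w :: "1 \<times> nat \<times> nat \<Rightarrow> real"
  defines "u \<equiv> w (1, 0, 0)" and "u_x \<equiv> w (1, 0, 1)" and "u_xx \<equiv> w (1, 0, 2)" and "u_xxx \<equiv> w (1, 0, 3)"
  assumes "u \<in> admissible p"
  shows "has_jderiv a b c (eq_u p) (t, x, w) (c (1, 1, 0) - c (1, 1, 2)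
    - (1/2 * (p + 1) * (p + 2) * (p * rpow u (p - 1) * c (1, 0, 0) * u_x + rpow u p * c (1, 0, 1))
       - (1/2 * p * (p - 1) * (p - 2) * rpow u (p - 3) * c (1, 0, 0) * u_x ^ 3
          + 1/2 * p * (p - 1) * rpow u (p - 2) * (3 * u_x\<^sup>2 * c (1, 0, 1)))
       - (2 * p * (p - 1) * rpow u (p - 2) * c (1, 0, 0) * u_x * u_xx
          + 2 * p * rpow u (p - 1) * (c (1, 0, 1) * u_xx + u_x * c (1, 0, 2)))
       - (p * rpow u (p - 1) * c (1, 0, 0) * u_xxx + rpow u p * c (1, 0, 3))))"
proof -
  have ad: "coord (1, 0, 0) (t, x, w) \<in> admissible p"
    using assms by simp
  have *: "eq_u p = (\<lambda>y. coord (1, 1, 0) y - coord (1, 1, 2) y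
      - (1/2 * (p + 1) * (p + 2) * rpow (coord (1, 0, 0) y) p * coord (1, 0, 1) y
         - 1/2 * p * (p - 1) * rpow (coord (1, 0, 0) y) (p - 2) * coord (1, 0, 1) y ^ 3
         - 2 * p * rpow (coord (1, 0, 0) y) (p - 1) * coord (1, 0, 1) y * coord (1, 0, 2) y
         - rpow (coord (1, 0, 0) y) p * coord (1, 0, 3) y))"
    by (auto simp: eq_u_def Let_def)
  show ?thesis
    unfolding *
    by (rule has_jderiv_eq_rhs, (rule has_jderiv_add has_jderiv_diff has_jderiv_rpow[OF ad]
        has_jderiv_coord has_jderiv_power3 has_jderiv_const has_jderiv_mult)+)
      (simp add: u_def u_x_def u_xx_def u_xxx_def field_simps power2_eq_square)
qed

lemma solution_spaceD:
  assumes "z \<in> solution_space D \<Delta>"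
  shows "base z \<in> D" "F \<in> \<Delta> \<Longrightarrow> F z = 0"
proof -
  show "base z \<in> D" using assms by (simp add: solution_space_def)
  assume "F \<in> \<Delta>"
  then have "(Dt ^^ 0) ((Dx ^^ 0) F) z = 0"
    using assms unfolding solution_space_def by blast
  then show "F z = 0" by simp
qed

section \<open>Translations and scalings are symmetries\<close>

lemma smooth_on_scaling:
  fixes X :: "'d::finite vfield"
  assumes "open D" "\<And>t x q. (t, x, q) \<in> D \<Longrightarrow> X (t, x, q) = (b - r * t, a, c *\<^sub>R q)"
  shows "smooth_on D X"
proof (rule smooth_on_cong_open[OF assms(1)])
  show "smooth_on D (\<lambda>z. (b, a, 0) + (- r * fst z, 0, c *\<^sub>R snd (snd z)))"
    by (intro smooth_on_affine linear_conv_bounded_linear[THEN iffD1] linearI)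
      (auto simp: algebra_simps)
  show "(b, a, 0) + (- r * fst y, 0, c *\<^sub>R snd (snd y)) = X y" if "y \<in> D" for y
    using that assms(2) by (cases y) auto
qed

text \<open>Euler's identity: with \<open>h0\<close>, ..., \<open>h3\<close> for u^p, ..., u^(p-3),
  the right-hand side of the evolution equation is homogeneous of degree p + 1 in u, m and their
  x-derivatives, the same weight as m_t. The hypotheses relate consecutive powers without division,
  so u = 0 is covered.\<close>

lemma eq_mt_scaling_identity:
  fixes p u h0 h1 h2 h3 c :: real
  assumes "p * h1 * u = p * h0" "(p - 1) * h2 * u = (p - 1) * h1"
    "(p - 1) * ((p - 2) * h3 * u) = (p - 1) * ((p - 2) * h2)"
  shows "c * (1 + p) * m_t - (2 * p * (p - 1) * h2 * (c * u) * u_x * m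
       + 2 * p * h1 * (c * u_x * m + u_x * (c * m))
       + p * h1 * (c * u) * m_x + h0 * (c * m_x)
       + 1/2 * p * (p - 1) * (p - 2) * h3 * (c * u) * (u\<^sup>2 - u_x\<^sup>2) * u_x
       + 1/2 * p * (p - 1) * h2
          * (2 * u * (c * u) * u_x + (u\<^sup>2 - 3 * u_x\<^sup>2) * (c * u_x)))
     = c * (1 + p) * (m_t - (2 * p * h1 * u_x * m + h0 * m_x + 1/2 * p * (p - 1) * h2 * (u\<^sup>2 - u_x\<^sup>2) * u_x))"
  using assms by algebra

lemma eq_u_scaling_identity:
  fixes p u h0 h1 h2 h3 c :: real
  assumes "p * h1 * u = p * h0" "(p - 1) * h2 * u = (p - 1) * h1"
    "(p - 1) * ((p - 2) * h3 * u) = (p - 1) * ((p - 2) * h2)"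
  shows "c * (1 + p) * u_t - c * (1 + p) * u_txx
    - (1/2 * (p + 1) * (p + 2) * (p * h1 * (c * u) * u_x + h0 * (c * u_x))
       - (1/2 * p * (p - 1) * (p - 2) * h3 * (c * u) * u_x ^ 3
          + 1/2 * p * (p - 1) * h2 * (3 * u_x\<^sup>2 * (c * u_x)))
       - (2 * p * (p - 1) * h2 * (c * u) * u_x * u_xx
          + 2 * p * h1 * (c * u_x * u_xx + u_x * (c * u_xx)))
       - (p * h1 * (c * u) * u_xxx + h0 * (c * u_xxx)))
    = c * (1 + p) * (u_t - u_txx - (1/2 * (p + 1) * (p + 2) * h0 * u_x
          - 1/2 * p * (p - 1) * h2 * u_x ^ 3 - 2 * p * h1 * u_x * u_xx - h0 * u_xxx))"
  using assms by algebra

text \<open>Both equations are eigenfunctions of the prolonged field, with eigenvalues c for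
  \<open>eq_m\<close> and c (1 + p) for \<open>eq_mt\<close>.\<close>

lemma point_symmetry_scaling_system:
  fixes X :: "2 vfield"
  assumes "open D" "\<forall>(t, x, q)\<in>D. q $ 1 \<in> admissible p"
    and X: "\<And>t x q. (t, x, q) \<in> D \<Longrightarrow> X (t, x, q) = (b - c * p * t, a, c *\<^sub>R q)"
  shows "point_symmetry D (um_system p) X"
  unfolding point_symmetry_def
proof (intro conjI ballI)
  show "smooth_on D X"
    by (rule smooth_on_scaling[OF assms(1) X])
  fix F and z :: "2 jet"
  assume F: "F \<in> um_system p" and z: "z \<in> solution_space D (um_system p)"
  obtain t x w where tw: "z = (t, x, w)" by (cases z) auto
  have D: "base (t, x, w) \<in> D" and eqs: "eq_m (t, x, w) = 0" "eq_mt p (t, x, w) = 0"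
    using solution_spaceD[OF z] by (auto simp: um_system_def tw)
  have u: "w (1, 0, 0) \<in> admissible p"
    using D assms(2) by (auto simp: base_def)
  have coeff: "prol_coeff X (\<alpha>, 0, j) (t, x, w) = c * w (\<alpha>, 0, j)"
    "prol_coeff X (\<alpha>, 1, j) (t, x, w) = c * (1 + p) * w (\<alpha>, 1, j)" for \<alpha> j
    using prol_coeff_scaling[OF assms(1) X D, of \<alpha> _ j] by simp_all
  have "prolong X eq_m (t, x, w) = c * eq_m (t, x, w)"
    by (rule prolong_eqI, rule has_jderiv_eq_rhs[OF has_jderiv_eq_m])
      (simp only: coeff eq_m_def Let_def prod.case algebra_simps)
  moreover have "prolong X (eq_mt p) (t, x, w) = c * (1 + p) * eq_mt p (t, x, w)"
    by (rule prolong_eqI, rule has_jderiv_eq_rhs[OF has_jderiv_eq_mt[of w p, OF u]])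
      (simp only: coeff eq_mt_def Let_def prod.case eq_mt_scaling_identity[OF mult_rpow_p[OF u]])
  ultimately show "prolong X F z = 0"
    using F eqs by (auto simp: um_system_def tw)
qed

lemma point_symmetry_scaling_eq_u:
  fixes X :: "1 vfield"
  assumes "open D" "\<forall>(t, x, q)\<in>D. q $ 1 \<in> admissible p"
    and X: "\<And>t x q. (t, x, q) \<in> D \<Longrightarrow> X (t, x, q) = (b - c * p * t, a, c *\<^sub>R q)"
  shows "point_symmetry D {eq_u p} X"
  unfolding point_symmetry_def
proof (intro conjI ballI)
  show "smooth_on D X"
    by (rule smooth_on_scaling[OF assms(1) X])
  fix F and z :: "1 jet"
  assume F: "F \<in> {eq_u p}" and z: "z \<in> solution_space D {eq_u p}"
  obtain t x w where tw: "z = (t, x, w)" by (cases z) auto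
  have D: "base (t, x, w) \<in> D" and eqs: "eq_u p (t, x, w) = 0"
    using solution_spaceD[OF z] by (auto simp: tw)
  have u: "w (1, 0, 0) \<in> admissible p"
    using D assms(2) by (auto simp: base_def)
  have coeff: "prol_coeff X (\<alpha>, 0, j) (t, x, w) = c * w (\<alpha>, 0, j)"
    "prol_coeff X (\<alpha>, 1, j) (t, x, w) = c * (1 + p) * w (\<alpha>, 1, j)" for \<alpha> j
    using prol_coeff_scaling[OF assms(1) X D, of \<alpha> _ j] by simp_all
  have "prolong X (eq_u p) (t, x, w) = c * (1 + p) * eq_u p (t, x, w)"
    by (rule prolong_eqI, rule has_jderiv_eq_rhs[OF has_jderiv_eq_u[of w p, OF u]])
      (simp only: coeff eq_u_def Let_def prod.case eq_u_scaling_identity[OF mult_rpow_p[OF u]])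
  then show "prolong X F z = 0"
    using F eqs by (simp add: tw)
qed

section \<open>The determining equations\<close>

abbreviation "d_t \<equiv> ddir ((1, 0, 0) :: 2 pnt)"
abbreviation "d_x \<equiv> ddir ((0, 1, 0) :: 2 pnt)"
abbreviation "d_u \<equiv> ddir ((0, 0, axis 1 1) :: 2 pnt)"
abbreviation "d_m \<equiv> ddir ((0, 0, axis 2 1) :: 2 pnt)"

lemma ddir_2_split:
  fixes A :: "2 pnt \<Rightarrow> real"
  assumes "A differentiable (at y)"
  shows "ddir (a, b, v) A y = a * d_t A y + b * d_x A y + v $ 1 * d_u A y + v $ 2 * d_m A y"
  by (subst ddir_split[OF assms]) (simp add: sum_2)

lemma xx_deriv_2:
  fixes A :: "2 pnt \<Rightarrow> real"
  assumes "smooth_on D A" "base (t, x, w) \<in> D"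
  defines "y \<equiv> base (t, x, w)" and "u_x \<equiv> w (1, 0, 1)" and "m_x \<equiv> w (2, 0, 1)"
  shows "xx_deriv A (t, x, w) = d_x (d_x A) y + u_x * d_u (d_x A) y + m_x * d_m (d_x A) y
    + w (1, 0, 2) * d_u A y + u_x * (d_x (d_u A) y + u_x * d_u (d_u A) y + m_x * d_m (d_u A) y)
    + w (2, 0, 2) * d_m A y + m_x * (d_x (d_m A) y + u_x * d_u (d_m A) y + m_x * d_m (d_m A) y)"
proof -
  note diff = smooth_on_differentiable[OF smooth_on_ddir[OF assms(1)] assms(2)]
  have "ddir (x_dir w) (ddir v A) y = d_x (ddir v A) y + u_x * d_u (ddir v A) y
      + m_x * d_m (ddir v A) y" for v
    unfolding y_def by (subst ddir_2_split[OF diff]) (simp add: u_x_def m_x_def)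
  then show ?thesis
    unfolding xx_deriv_def prod.case by (simp add: sum_2 y_def u_x_def m_x_def)
qed

text \<open>Supplies the evaluation points for every comparison of coefficients below: seven
  coordinates are prescribed, and the last two equations state what the system forces on u_xx and
  m_t.\<close>

lemma solution_jet_exists:
  fixes q :: "real ^ 2"
  assumes "(t, x, q) \<in> D"
  obtains w where "base (t, x, w) = (t, x, q)" "(t, x, w) \<in> solution_space D (um_system p)"
    "w (1, 0, 0) = q $ 1" "w (2, 0, 0) = q $ 2" "w (1, 0, 1) = u_x" "w (1, 1, 0) = u_t"
    "w (1, 1, 1) = u_tx" "w (2, 0, 1) = m_x" "w (2, 0, 2) = m_xx" "w (1, 0, 2) = q $ 1 - q $ 2"
    "w (2, 1, 0) = 2 * p * rpow (q $ 1) (p - 1) * u_x * q $ 2 + rpow (q $ 1) p * m_x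
          + 1/2 * p * (p - 1) * rpow (q $ 1) (p - 2) * ((q $ 1)\<^sup>2 - u_x\<^sup>2) * u_x"
proof -
  \<comment> \<open>\<open>a\<close> and \<open>b\<close> are the t-derivatives of u and u_x,
    \<open>c\<close> the x-derivatives of m. Entries beyond the prescribed ones just repeat the last
    value.\<close>
  define a where "a i = (if i = 0 then q $ 1 else u_t)" for i :: nat
  define b where "b i = (if i = 0 then u_x else u_tx)" for i :: nat
  define c where "c j = (if j = 0 then q $ 2 else if j = 1 then m_x else m_xx)" for j :: nat
  obtain w :: "2 \<times> nat \<times> nat \<Rightarrow> real" where w: "\<And>i. w (1, i, 0) = a i" "\<And>i. w (1, i, 1) = b i"
    "\<And>j. w (2, 0, j) = c j"
    and eqs: "\<And>i j. (Dt ^^ i) ((Dx ^^ j) eq_m) (t, x, w) = 0"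
      "\<And>i j. (Dt ^^ i) ((Dx ^^ j) (eq_mt p)) (t, x, w) = 0"
    using formal_solution_exists[OF solved_for_eq_mt, of a b c t x p] by metis
  have base: "base (t, x, w) = (t, x, q)"
    by (simp add: base_def w a_def c_def vec_eq_iff forall_2)
  have sol: "(t, x, w) \<in> solution_space D (um_system p)"
    using assms eqs by (auto simp: solution_space_def um_system_def base)
  have "w (1, 0, 2) = q $ 1 - q $ 2"
    using eqs(1)[of 0 0] by (simp add: eq_m_def Let_def w a_def c_def)
  moreover have "w (2, 1, 0) = 2 * p * rpow (q $ 1) (p - 1) * u_x * q $ 2 + rpow (q $ 1) p * m_x
          + 1/2 * p * (p - 1) * rpow (q $ 1) (p - 2) * ((q $ 1)\<^sup>2 - u_x\<^sup>2) * u_x"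
    using eqs(2)[of 0 0] w(1)[of 0] w(2)[of 0] w(3)[of 0] w(3)[of 1]
    by (simp add: eq_mt_def Let_def a_def b_def c_def)
  ultimately show ?thesis
    using that[OF base sol] w(1)[of 0] w(1)[of 1] w(2)[of 0] w(2)[of 1] w(3)[of 0] w(3)[of 1] w(3)[of 2]
    by (simp add: a_def b_def c_def)
qed

lemma cubic_eq_0:
  fixes c0 c1 c2 c3 :: real
  assumes "\<And>s. c0 + c1 * s + c2 * s\<^sup>2 + c3 * s ^ 3 = 0"
  shows "c0 = 0" "c1 = 0" "c2 = 0" "c3 = 0"
  using assms[of 0] assms[of 1] assms[of "-1"] assms[of 2] by simp_all

text \<open>Pure algebra at one point, with \<open>h0\<close>, ..., \<open>h3\<close> for u^p, ...,
  u^(p-3). The conclusions are, in this order and up to constant factors, the coefficients of u_t,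
  m_x, 1, u_x^2, u_x and u_x^3.\<close>

lemma eq_mt_coefficients:
  fixes \<phi>_t \<phi>_x \<phi>_u \<phi>_m \<tau>_t \<xi>_t \<xi>_x \<eta> \<eta>_x \<eta>_u \<phi> p u m h0 h1 h2 h3 :: real
  assumes "\<And>u_t u_x m_x m_t. m_t = 2 * p * h1 * u_x * m + h0 * m_x + 1/2 * p * (p - 1) * h2 * (u\<^sup>2 - u_x\<^sup>2) * u_x \<Longrightarrow>
    \<phi>_t + u_t * \<phi>_u + m_t * \<phi>_m - \<tau>_t * m_t - \<xi>_t * m_x
    - (2 * p * (p - 1) * h2 * \<eta> * u_x * m
       + 2 * p * h1 * ((\<eta>_x + u_x * \<eta>_u - \<xi>_x * u_x) * m + u_x * \<phi>)
       + p * h1 * \<eta> * m_x + h0 * (\<phi>_x + u_x * \<phi>_u + m_x * \<phi>_m - \<xi>_x * m_x)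
       + 1/2 * p * (p - 1) * (p - 2) * h3 * \<eta> * (u\<^sup>2 - u_x\<^sup>2) * u_x
       + 1/2 * p * (p - 1) * h2
          * (2 * u * \<eta> * u_x + (u\<^sup>2 - 3 * u_x\<^sup>2) * (\<eta>_x + u_x * \<eta>_u - \<xi>_x * u_x))) = 0"
  shows "\<phi>_u = 0"
    and "h0 * (\<xi>_x - \<tau>_t) - \<xi>_t - p * h1 * \<eta> = 0"
    and "\<phi>_t - 2 * p * h1 * \<eta>_x * m - h0 * \<phi>_x - 1/2 * p * (p - 1) * h2 * u\<^sup>2 * \<eta>_x = 0"
    and "p * (p - 1) * h2 * \<eta>_x = 0"
    and "(2 * p * h1 * m + 1/2 * p * (p - 1) * h2 * u\<^sup>2) * (\<phi>_m - \<tau>_t)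
      - 2 * p * (p - 1) * h2 * \<eta> * m - 2 * p * h1 * ((\<eta>_u - \<xi>_x) * m + \<phi>)
      - 1/2 * p * (p - 1) * (p - 2) * h3 * \<eta> * u\<^sup>2
      - 1/2 * p * (p - 1) * h2 * (2 * u * \<eta> + u\<^sup>2 * (\<eta>_u - \<xi>_x)) = 0"
    and "p * (p - 1) * (h2 * (\<phi>_m - \<tau>_t) - (p - 2) * h3 * \<eta> - 3 * h2 * (\<eta>_u - \<xi>_x)) = 0"
proof -
  show \<phi>_u: "\<phi>_u = 0"
    using assms[OF refl, of 0 0 0] assms[OF refl, of 1 0 0] by simp
  show "h0 * (\<xi>_x - \<tau>_t) - \<xi>_t - p * h1 * \<eta> = 0"
    using assms[OF refl, of 0 0 0] assms[OF refl, of 0 0 1] by (simp add: algebra_simps)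
  have "(\<phi>_t - 2 * p * h1 * \<eta>_x * m - h0 * \<phi>_x - 1/2 * p * (p - 1) * h2 * u\<^sup>2 * \<eta>_x)
    + ((2 * p * h1 * m + 1/2 * p * (p - 1) * h2 * u\<^sup>2) * (\<phi>_m - \<tau>_t)
      - 2 * p * (p - 1) * h2 * \<eta> * m - 2 * p * h1 * ((\<eta>_u - \<xi>_x) * m + \<phi>)
      - 1/2 * p * (p - 1) * (p - 2) * h3 * \<eta> * u\<^sup>2
      - 1/2 * p * (p - 1) * h2 * (2 * u * \<eta> + u\<^sup>2 * (\<eta>_u - \<xi>_x))) * s
    + 3/2 * p * (p - 1) * h2 * \<eta>_x * s\<^sup>2
    + (- 1/2 * (p * (p - 1) * (h2 * (\<phi>_m - \<tau>_t) - (p - 2) * h3 * \<eta> - 3 * h2 * (\<eta>_u - \<xi>_x)))) * s ^ 3 = 0" for s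
    using assms[OF refl, of 0 s 0] \<phi>_u by algebra
  note c = cubic_eq_0[OF this]
  show "\<phi>_t - 2 * p * h1 * \<eta>_x * m - h0 * \<phi>_x - 1/2 * p * (p - 1) * h2 * u\<^sup>2 * \<eta>_x = 0"
    by (rule c(1))
  show "p * (p - 1) * h2 * \<eta>_x = 0" using c(3) by simp
  show "(2 * p * h1 * m + 1/2 * p * (p - 1) * h2 * u\<^sup>2) * (\<phi>_m - \<tau>_t)
      - 2 * p * (p - 1) * h2 * \<eta> * m - 2 * p * h1 * ((\<eta>_u - \<xi>_x) * m + \<phi>)
      - 1/2 * p * (p - 1) * (p - 2) * h3 * \<eta> * u\<^sup>2
      - 1/2 * p * (p - 1) * h2 * (2 * u * \<eta> + u\<^sup>2 * (\<eta>_u - \<xi>_x)) = 0"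
    by (rule c(2))
  show "p * (p - 1) * (h2 * (\<phi>_m - \<tau>_t) - (p - 2) * h3 * \<eta> - 3 * h2 * (\<eta>_u - \<xi>_x)) = 0"
    using c(4) by simp
qed

text \<open>Allows an identity valid throughout an open set to be differentiated: its left side is
  differentiated by the usual rules, and the result is 0 in every direction.\<close>

lemma ddir_identity:
  assumes "open S" "y \<in> S" "\<And>z. z \<in> S \<Longrightarrow> f z = 0" "(f has_derivative f') (at y)"
  shows "f' v = 0"
proof -
  have "((\<lambda>_. 0) has_derivative f') (at y)"
    by (rule has_derivative_transform_within_open[OF assms(4,1,2)]) (use assms(3) in auto)
  then show ?thesis
    using has_derivative_unique[OF _ has_derivative_const] by (metis)
qed

lemma ddir_eq_0:
  assumes "open S" "y \<in> S" "\<And>z. z \<in> S \<Longrightarrow> f z = 0"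
  shows "ddir v f y = 0"
proof -
  have "ddir v (\<lambda>_. 0) y = ddir v f y"
    by (rule ddir_cong_open[OF assms(1,2)]) (simp_all add: assms(3))
  then show ?thesis by (simp add: ddir_def)
qed

lemma axis_component: "axis i x $ j = (if j = i then x else 0)"
  by (simp add: axis_def)

lemma has_derivative_component [derivative_intros]:
  "((\<lambda>y :: 2 pnt. snd (snd y) $ i) has_derivative (\<lambda>v. snd (snd v) $ i)) (at y)"
  by (intro bounded_linear_imp_has_derivative
    bounded_linear_compose[OF bounded_linear_vec_nth] bounded_linear_intros)

section \<open>The two invariance conditions as identities over D\<close>

context
  fixes p :: real and D :: "2 pnt set" and X :: "2 vfield"
  assumes D: "open D" "\<forall>(t, x, q)\<in>D. q $ 1 \<in> admissible p"
    and X: "point_symmetry D (um_system p) X"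
begin

abbreviation (input) "\<tau> \<equiv> \<lambda>y. fst (X y)"
abbreviation (input) "\<xi> \<equiv> \<lambda>y. fst (snd (X y))"
abbreviation (input) "\<eta> \<equiv> \<lambda>y. snd (snd (X y)) $ 1"
abbreviation (input) "\<phi> \<equiv> \<lambda>y. snd (snd (X y)) $ 2"

lemma smooth_symmetry:
  "smooth_on D \<tau>" "smooth_on D \<xi>" "smooth_on D \<eta>" "smooth_on D \<phi>"
  using smooth_on_components[OF D(1)] X by (auto simp: point_symmetry_def)

text \<open>Here the jet is eliminated: at a fixed point of D the condition becomes an identity in
  five free reals. \<open>dx\<close> and \<open>dxx\<close> are the first and second total
  x-derivative, with u_xx replaced by u - m.\<close>

lemma invariance_eq_m:
  fixes t x u_t u_x u_tx m_x m_xx :: real and q :: "real ^ 2"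
  assumes "(t, x, q) \<in> D"
  defines "y \<equiv> (t, x, q)"
  defines "dx A \<equiv> d_x A y + u_x * d_u A y + m_x * d_m A y"
  defines "dxx A \<equiv> d_x (d_x A) y + u_x * d_u (d_x A) y + m_x * d_m (d_x A) y
    + (q $ 1 - q $ 2) * d_u A y + u_x * (d_x (d_u A) y + u_x * d_u (d_u A) y + m_x * d_m (d_u A) y)
    + m_xx * d_m A y + m_x * (d_x (d_m A) y + u_x * d_u (d_m A) y + m_x * d_m (d_m A) y)"
  shows "\<phi> y - \<eta> y + dxx \<eta> - dxx \<tau> * u_t - 2 * dx \<tau> * u_tx - dxx \<xi> * u_x
    - 2 * dx \<xi> * (q $ 1 - q $ 2) = 0"
proof -
  obtain w where w: "base (t, x, w) = (t, x, q)" "(t, x, w) \<in> solution_space D (um_system p)"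
    "w (1, 0, 0) = q $ 1" "w (2, 0, 0) = q $ 2" "w (1, 0, 1) = u_x" "w (1, 1, 0) = u_t"
    "w (1, 1, 1) = u_tx" "w (2, 0, 1) = m_x" "w (2, 0, 2) = m_xx" "w (1, 0, 2) = q $ 1 - q $ 2"
    by (rule solution_jet_exists[OF assms(1), of p u_x u_t u_tx m_x m_xx])
  have b: "base (t, x, w) \<in> D" using w(1) assms(1) by simp
  have sX: "smooth_on D X" using X by (simp add: point_symmetry_def)
  note s = smooth_symmetry
  have "prolong X eq_m (t, x, w) = 0"
    using X w(2) by (auto simp: point_symmetry_def um_system_def)
  then have "prol_coeff X (2, 0, 0) (t, x, w) - (prol_coeff X (1, 0, 0) (t, x, w)
     - prol_coeff X (1, 0, 2) (t, x, w)) = 0"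
    using prolong_eqI[OF has_jderiv_eq_m, of X "(t, x, w)"] by simp
  moreover have x: "ddir (x_dir w) A (base (t, x, w)) = dx A" if "smooth_on D A" for A
    unfolding dx_def y_def w(1)
    by (subst ddir_2_split[OF smooth_on_differentiable[OF that assms(1)]]) (use w in simp)
  moreover have xx: "xx_deriv A (t, x, w) = dxx A" if "smooth_on D A" for A
    unfolding xx_deriv_2[OF that b] dxx_def y_def w by simp
  moreover have "prol_coeff X (1, 0, 0) (t, x, w) = \<eta> y" "prol_coeff X (2, 0, 0) (t, x, w) = \<phi> y"
    by (simp_all add: prol_coeff_00 vf_eta_def w(1) y_def)
  moreover have "prol_coeff X (1, 0, 2) (t, x, w) = dxx \<eta> - dxx \<tau> * u_t - 2 * dx \<tau> * u_tx
      - dxx \<xi> * u_x - 2 * dx \<xi> * (q $ 1 - q $ 2)"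
    by (simp only: prol_coeff_xx[OF D(1) sX b] x[OF s(1)] x[OF s(2)] xx[OF s(1)] xx[OF s(2)]
        xx[OF s(3)] w(3-))
  ultimately show ?thesis
    by linarith
qed

lemma invariance_eq_mt:
  fixes t x u_t u_x m_x :: real and q :: "real ^ 2"
  assumes "(t, x, q) \<in> D"
  defines "y \<equiv> (t, x, q)" and "u \<equiv> q $ 1" and "m \<equiv> q $ 2"
  defines "m_t \<equiv> 2 * p * rpow u (p - 1) * u_x * m + rpow u p * m_x
          + 1/2 * p * (p - 1) * rpow u (p - 2) * (u\<^sup>2 - u_x\<^sup>2) * u_x"
  defines "dx A \<equiv> d_x A y + u_x * d_u A y + m_x * d_m A y"
  defines "dt A \<equiv> d_t A y + u_t * d_u A y + m_t * d_m A y"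
  defines "\<eta>x \<equiv> dx \<eta> - dx \<tau> * u_t - dx \<xi> * u_x"
  shows "dt \<phi> - dt \<tau> * m_t - dt \<xi> * m_x
    - (2 * p * (p - 1) * rpow u (p - 2) * \<eta> y * u_x * m
       + 2 * p * rpow u (p - 1) * (\<eta>x * m + u_x * \<phi> y)
       + p * rpow u (p - 1) * \<eta> y * m_x + rpow u p * (dx \<phi> - dx \<tau> * m_t - dx \<xi> * m_x)
       + 1/2 * p * (p - 1) * (p - 2) * rpow u (p - 3) * \<eta> y * (u\<^sup>2 - u_x\<^sup>2) * u_x
       + 1/2 * p * (p - 1) * rpow u (p - 2)
          * (2 * u * \<eta> y * u_x + (u\<^sup>2 - 3 * u_x\<^sup>2) * \<eta>x)) = 0"
proof -
  obtain w where w: "base (t, x, w) = (t, x, q)" "(t, x, w) \<in> solution_space D (um_system p)"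
    "w (1, 0, 0) = u" "w (2, 0, 0) = m" "w (1, 0, 1) = u_x" "w (1, 1, 0) = u_t"
    "w (2, 0, 1) = m_x" "w (2, 1, 0) = m_t"
    unfolding u_def m_def m_t_def
    by (rule solution_jet_exists[OF assms(1), of p u_x u_t 0 m_x 0])
  have b: "base (t, x, w) \<in> D" using w(1) assms(1) by simp
  have u: "w (1, 0, 0) \<in> admissible p" using assms(1) D(2) by (auto simp: w u_def)
  have sX: "smooth_on D X" using X by (simp add: point_symmetry_def)
  note s = smooth_symmetry
  have x: "ddir (x_dir w) A (base (t, x, w)) = dx A" if "smooth_on D A" for A
    unfolding dx_def y_def w(1)
    by (subst ddir_2_split[OF smooth_on_differentiable[OF that assms(1)]]) (use w in simp)
  have t: "ddir (t_dir w) A (base (t, x, w)) = dt A" if "smooth_on D A" for A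
    unfolding dt_def y_def w(1)
    by (subst ddir_2_split[OF smooth_on_differentiable[OF that assms(1)]]) (use w in simp)
  have coeff: "prol_coeff X (1, 0, 0) (t, x, w) = \<eta> y" "prol_coeff X (2, 0, 0) (t, x, w) = \<phi> y"
      "prol_coeff X (1, 0, 1) (t, x, w) = \<eta>x"
      "prol_coeff X (2, 0, 1) (t, x, w) = dx \<phi> - dx \<tau> * m_t - dx \<xi> * m_x"
      "prol_coeff X (2, 1, 0) (t, x, w) = dt \<phi> - dt \<tau> * m_t - dt \<xi> * m_x"
    by (simp_all only: prol_coeff_00 prol_coeff_x[OF D(1) sX b] prol_coeff_t[OF D(1) sX b]
        x[OF s(1)] x[OF s(2)] x[OF s(3)] x[OF s(4)] t[OF s(1)] t[OF s(2)] t[OF s(4)] w(3-) \<eta>x_def)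
      (simp_all add: vf_eta_def w(1) y_def)
  have "prolong X (eq_mt p) (t, x, w) = 0"
    using X w(2) by (auto simp: point_symmetry_def um_system_def)
  then show ?thesis
    using prolong_eqI[OF has_jderiv_eq_mt[of w p, OF u], of X t x] by (simp only: w(3-) coeff)
qed

section \<open>Consequences of the first condition\<close>

abbreviation (input) "u \<equiv> \<lambda>y :: 2 pnt. snd (snd y) $ 1"
abbreviation (input) "m \<equiv> \<lambda>y :: 2 pnt. snd (snd y) $ 2"

lemmas smooth_d = smooth_symmetry[THEN smooth_on_ddir]
lemmas smooth_dd = smooth_d[THEN smooth_on_ddir]

lemmas has_deriv = smooth_symmetry[THEN smooth_on_differentiable, THEN has_derivative_ddir]
lemmas has_deriv_d = smooth_d[THEN smooth_on_differentiable, THEN has_derivative_ddir]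
lemmas has_deriv_dd = smooth_dd[THEN smooth_on_differentiable, THEN has_derivative_ddir]

text \<open>The coefficient of \<open>m\<^sub>x\<^sub>x\<close> in the first condition is \<open>\<eta>\<^sub>m - \<tau>\<^sub>m u\<^sub>t - \<xi>\<^sub>m u\<^sub>x\<close>.\<close>
lemma independent_of_m:
  assumes "y \<in> D"
  shows "d_m \<eta> y = 0" "d_m \<tau> y = 0" "d_m \<xi> y = 0"
proof -
  obtain t x q where y: "y = (t, x, q)" by (cases y) auto
  note inv = invariance_eq_m[OF assms[unfolded y], where u_tx = 0 and m_x = 0, folded y]
  show 1: "d_m \<eta> y = 0"
    using inv[where u_t = 0 and u_x = 0 and m_xx = 0] inv[where u_t = 0 and u_x = 0 and m_xx = 1]
    by (simp add: algebra_simps)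
  show 2: "d_m \<tau> y = 0"
    using inv[where u_t = 1 and u_x = 0 and m_xx = 0] inv[where u_t = 1 and u_x = 0 and m_xx = 1] 1
    by (simp add: algebra_simps)
  show "d_m \<xi> y = 0"
    using inv[where u_t = 0 and u_x = 1 and m_xx = 0] inv[where u_t = 0 and u_x = 1 and m_xx = 1] 1
    by (simp add: algebra_simps)
qed

lemma independent_of_m_d:
  assumes "y \<in> D"
  shows "d_m (ddir v \<eta>) y = 0" "d_m (ddir v \<tau>) y = 0" "d_m (ddir v \<xi>) y = 0"
    "d_m (ddir v' (ddir v \<eta>)) y = 0" "d_m (ddir v' (ddir v \<xi>)) y = 0" "d_m (ddir v' (ddir v \<tau>)) y = 0"
proof -
  note 0 = ddir_ddir_eq_0[OF D(1)]
  show "d_m (ddir v \<eta>) y = 0" "d_m (ddir v \<tau>) y = 0" "d_m (ddir v \<xi>) y = 0"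
    by (rule 0 smooth_symmetry independent_of_m assms | assumption)+
  show "d_m (ddir v' (ddir v \<eta>)) y = 0" "d_m (ddir v' (ddir v \<xi>)) y = 0" "d_m (ddir v' (ddir v \<tau>)) y = 0"
    by (rule 0 smooth_d smooth_symmetry independent_of_m assms | assumption)+
qed

text \<open>The coefficient of \<open>u\<^sub>t\<^sub>x\<close> is \<open>- 2 (\<tau>\<^sub>x + \<tau>\<^sub>u u\<^sub>x)\<close>.\<close>
lemma tau_only_t:
  assumes "y \<in> D"
  shows "d_x \<tau> y = 0" "d_u \<tau> y = 0"
proof -
  obtain t x q where y: "y = (t, x, q)" by (cases y) auto
  note inv = invariance_eq_m[OF assms[unfolded y], where u_t = 0 and m_x = 0 and m_xx = 0, folded y]
  show 1: "d_x \<tau> y = 0"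
    using inv[where u_tx = 0 and u_x = 0] inv[where u_tx = 1 and u_x = 0] by simp
  show 2: "d_u \<tau> y = 0"
    using inv[where u_tx = 0 and u_x = 1] inv[where u_tx = 1 and u_x = 1] 1 by simp
qed

lemma tau_only_t_d:
  assumes "y \<in> D"
  shows "d_x (ddir v \<tau>) y = 0" "d_u (ddir v \<tau>) y = 0"
  by (rule ddir_ddir_eq_0[OF D(1)] smooth_symmetry tau_only_t assms | assumption)+

text \<open>With the other parameters set to 0 the condition is a cubic in u_x. The factor 3 of
  \<open>d_u \<xi>\<close> arises as 1 from the second total derivative of \<xi> and 2 from the term
  with u_xx.\<close>

lemma eq_m_coefficients:
  assumes "y \<in> D"
  shows "\<phi> y - \<eta> y + d_x (d_x \<eta>) y + (u y - m y) * (d_u \<eta> y - 2 * d_x \<xi> y) = 0"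
    "d_u (d_x \<eta>) y + d_x (d_u \<eta>) y - d_x (d_x \<xi>) y - 3 * (u y - m y) * d_u \<xi> y = 0"
    "d_u (d_u \<eta>) y - (d_u (d_x \<xi>) y + d_x (d_u \<xi>) y) = 0"
proof -
  obtain t x q where y: "y = (t, x, q)" by (cases y) auto
  note inv = invariance_eq_m[OF assms[unfolded y], where u_t = 0 and u_tx = 0 and m_x = 0 and m_xx = 0,
      folded y]
  have "(\<phi> y - \<eta> y + d_x (d_x \<eta>) y + (u y - m y) * (d_u \<eta> y - 2 * d_x \<xi> y))
    + (d_u (d_x \<eta>) y + d_x (d_u \<eta>) y - d_x (d_x \<xi>) y - 3 * (u y - m y) * d_u \<xi> y) * s
    + (d_u (d_u \<eta>) y - (d_u (d_x \<xi>) y + d_x (d_u \<xi>) y)) * s\<^sup>2 + (- d_u (d_u \<xi>) y) * s ^ 3 = 0" for s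
    using inv[where u_x = s] by (simp add: y algebra_simps power2_eq_square power3_eq_cube)
  note c = cubic_eq_0[OF this]
  show "\<phi> y - \<eta> y + d_x (d_x \<eta>) y + (u y - m y) * (d_u \<eta> y - 2 * d_x \<xi> y) = 0"
    "d_u (d_x \<eta>) y + d_x (d_u \<eta>) y - d_x (d_x \<xi>) y - 3 * (u y - m y) * d_u \<xi> y = 0"
    "d_u (d_u \<eta>) y - (d_u (d_x \<xi>) y + d_x (d_u \<xi>) y) = 0"
    by (rule c(1) c(2) c(3))+
qed

text \<open>In the coefficient of u_x, the variable m enters through 3 (u - m) alone, since all
  derivatives of \<xi> and \<eta> are independent of m. Differentiating by m leaves 3
  \<open>d_u \<xi>\<close> = 0.\<close>

lemma xi_independent_of_u:
  assumes "y \<in> D"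
  shows "d_u \<xi> y = 0"
proof -
  have "((\<lambda>y. d_u (d_x \<eta>) y + d_x (d_u \<eta>) y - d_x (d_x \<xi>) y - 3 * (u y - m y) * d_u \<xi> y)
    has_derivative (\<lambda>v. ddir v (d_u (d_x \<eta>)) y + ddir v (d_x (d_u \<eta>)) y - ddir v (d_x (d_x \<xi>)) y
      - (3 * (u y - m y) * ddir v (d_u \<xi>) y + 3 * (u v - m v) * d_u \<xi> y))) (at y)"
    by (rule derivative_eq_intros has_deriv_d[OF assms] has_deriv_dd[OF assms] refl)+
      (simp add: algebra_simps)
  from ddir_identity[OF D(1) assms eq_m_coefficients(2) this, of "(0, 0, axis 2 1)"]
  show ?thesis
    by (simp add: independent_of_m_d[OF assms] axis_component)
qed

lemma xi_independent_of_u_d: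
  assumes "y \<in> D"
  shows "ddir v (d_u \<xi>) y = 0" "d_u (ddir v \<xi>) y = 0" "d_u (ddir v' (ddir v \<xi>)) y = 0"
    "d_u (ddir v'' (ddir v' (ddir v \<xi>))) y = 0"
  by (rule ddir_eq_0[OF D(1) assms] xi_independent_of_u | assumption)
    (rule ddir_ddir_eq_0[OF D(1)] smooth_symmetry smooth_d smooth_dd xi_independent_of_u assms | assumption)+

lemma d_phi:
  assumes "y \<in> D"
  shows "ddir v \<phi> y = ddir v \<eta> y - ddir v (d_x (d_x \<eta>)) y - (u y - m y) * (ddir v (d_u \<eta>) y
    - 2 * ddir v (d_x \<xi>) y) - (u v - m v) * (d_u \<eta> y - 2 * d_x \<xi> y)"
proof -
  have "((\<lambda>y. \<phi> y - \<eta> y + d_x (d_x \<eta>) y + (u y - m y) * (d_u \<eta> y - 2 * d_x \<xi> y))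
    has_derivative (\<lambda>v. ddir v \<phi> y - ddir v \<eta> y + ddir v (d_x (d_x \<eta>)) y
     + ((u y - m y) * (ddir v (d_u \<eta>) y - 2 * ddir v (d_x \<xi>) y) + (u v - m v) * (d_u \<eta> y - 2 * d_x \<xi> y)))) (at y)"
    by (rule derivative_eq_intros has_deriv[OF assms] has_deriv_d[OF assms] has_deriv_dd[OF assms] refl)+
      (simp add: algebra_simps)
  from ddir_identity[OF D(1) assms eq_m_coefficients(1) this, of v]
  show ?thesis by simp
qed

lemma d_phi_m: "y \<in> D \<Longrightarrow> d_m \<phi> y = d_u \<eta> y - 2 * d_x \<xi> y"
  by (simp add: d_phi independent_of_m independent_of_m_d axis_component)

text \<open>Differentiating the formula for \<phi> by u, \<open>d_u \<eta>\<close> cancels and the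
  second u-derivative of \<eta> vanishes. Since the second condition gives \<open>d_u \<phi>\<close>
  = 0, this is what ties \<open>d_x \<xi>\<close> to \<eta>.\<close>

lemma d_phi_u: "y \<in> D \<Longrightarrow> d_u \<phi> y = 2 * d_x \<xi> y - d_u (d_x (d_x \<eta>)) y"
  using eq_m_coefficients(3)[of y]
  by (simp add: d_phi xi_independent_of_u_d axis_component)

section \<open>Consequences of the second condition\<close>

lemma admissible_u: "y \<in> D \<Longrightarrow> u y \<in> admissible p"
  using D(2) by auto

lemma coefficients_eq_mt:
  assumes "y \<in> D"
  defines "h0 \<equiv> rpow (u y) p" and "h1 \<equiv> rpow (u y) (p - 1)"
    and "h2 \<equiv> rpow (u y) (p - 2)" and "h3 \<equiv> rpow (u y) (p - 3)"
  shows "d_u \<phi> y = 0"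
    and "h0 * (d_x \<xi> y - d_t \<tau> y) - d_t \<xi> y - p * h1 * \<eta> y = 0"
    and "d_t \<phi> y - 2 * p * h1 * d_x \<eta> y * m y - h0 * d_x \<phi> y - 1/2 * p * (p - 1) * h2 * (u y)\<^sup>2 * d_x \<eta> y = 0"
    and "p * (p - 1) * h2 * d_x \<eta> y = 0"
    and "(2 * p * h1 * m y + 1/2 * p * (p - 1) * h2 * (u y)\<^sup>2) * (d_m \<phi> y - d_t \<tau> y)
      - 2 * p * (p - 1) * h2 * \<eta> y * m y - 2 * p * h1 * ((d_u \<eta> y - d_x \<xi> y) * m y + \<phi> y)
      - 1/2 * p * (p - 1) * (p - 2) * h3 * \<eta> y * (u y)\<^sup>2
      - 1/2 * p * (p - 1) * h2 * (2 * u y * \<eta> y + (u y)\<^sup>2 * (d_u \<eta> y - d_x \<xi> y)) = 0"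
    and "p * (p - 1) * (h2 * (d_m \<phi> y - d_t \<tau> y) - (p - 2) * h3 * \<eta> y
      - 3 * h2 * (d_u \<eta> y - d_x \<xi> y)) = 0"
proof -
  obtain t x q where y: "y = (t, x, q)" by (cases y) auto
  have uy: "u y = q $ 1" "m y = q $ 2" by (simp_all add: y)
  note inv = invariance_eq_mt[OF assms(1)[unfolded y], folded y, folded uy, folded h0_def h1_def h2_def h3_def]
  \<comment> \<open>Dropping these derivatives turns the condition into the hypothesis of
    \<open>eq_mt_coefficients\<close>.\<close>
  note zeros = independent_of_m[OF assms(1)] tau_only_t[OF assms(1)] xi_independent_of_u[OF assms(1)]
    mult_zero_left mult_zero_right add_0_left add_0_right diff_0_right
  have "d_t \<phi> y + u_t * d_u \<phi> y + m_t * d_m \<phi> y - d_t \<tau> y * m_t - d_t \<xi> y * m_x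
    - (2 * p * (p - 1) * h2 * \<eta> y * u_x * m y
       + 2 * p * h1 * ((d_x \<eta> y + u_x * d_u \<eta> y - d_x \<xi> y * u_x) * m y + u_x * \<phi> y)
       + p * h1 * \<eta> y * m_x + h0 * (d_x \<phi> y + u_x * d_u \<phi> y + m_x * d_m \<phi> y - d_x \<xi> y * m_x)
       + 1/2 * p * (p - 1) * (p - 2) * h3 * \<eta> y * ((u y)\<^sup>2 - u_x\<^sup>2) * u_x
       + 1/2 * p * (p - 1) * h2
          * (2 * u y * \<eta> y * u_x + ((u y)\<^sup>2 - 3 * u_x\<^sup>2) * (d_x \<eta> y + u_x * d_u \<eta> y - d_x \<xi> y * u_x))) = 0"
    if "m_t = 2 * p * h1 * u_x * m y + h0 * m_x + 1/2 * p * (p - 1) * h2 * ((u y)\<^sup>2 - u_x\<^sup>2) * u_x"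
    for u_t u_x m_x m_t
    using inv[where u_t = u_t and u_x = u_x and m_x = m_x] unfolding that by (simp only: zeros)
  note * = eq_mt_coefficients[OF this]
  show "d_u \<phi> y = 0"
    "h0 * (d_x \<xi> y - d_t \<tau> y) - d_t \<xi> y - p * h1 * \<eta> y = 0"
    "d_t \<phi> y - 2 * p * h1 * d_x \<eta> y * m y - h0 * d_x \<phi> y - 1/2 * p * (p - 1) * h2 * (u y)\<^sup>2 * d_x \<eta> y = 0"
    "p * (p - 1) * h2 * d_x \<eta> y = 0"
    "(2 * p * h1 * m y + 1/2 * p * (p - 1) * h2 * (u y)\<^sup>2) * (d_m \<phi> y - d_t \<tau> y)
      - 2 * p * (p - 1) * h2 * \<eta> y * m y - 2 * p * h1 * ((d_u \<eta> y - d_x \<xi> y) * m y + \<phi> y)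
      - 1/2 * p * (p - 1) * (p - 2) * h3 * \<eta> y * (u y)\<^sup>2
      - 1/2 * p * (p - 1) * h2 * (2 * u y * \<eta> y + (u y)\<^sup>2 * (d_u \<eta> y - d_x \<xi> y)) = 0"
    "p * (p - 1) * (h2 * (d_m \<phi> y - d_t \<tau> y) - (p - 2) * h3 * \<eta> y
      - 3 * h2 * (d_u \<eta> y - d_x \<xi> y)) = 0"
    by (rule *, assumption)+
qed

text \<open>The derivative of the coefficient of m_x in an arbitrary direction v; it is needed along
  u and along x.\<close>

lemma d_coefficient_m_x:
  assumes "y \<in> D"
  shows "p * rpow (u y) (p - 1) * u v * (d_x \<xi> y - d_t \<tau> y)
    + rpow (u y) p * (ddir v (d_x \<xi>) y - ddir v (d_t \<tau>) y) - ddir v (d_t \<xi>) y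
    - (p * (p - 1) * rpow (u y) (p - 2) * u v * \<eta> y + p * rpow (u y) (p - 1) * ddir v \<eta> y) = 0"
proof -
  have "((\<lambda>y. rpow (u y) p) has_derivative (\<lambda>v. p * rpow (u y) (p - 1) * u v)) (at y)"
    "((\<lambda>y. p * rpow (u y) (p - 1)) has_derivative (\<lambda>v. p * (p - 1) * rpow (u y) (p - 2) * u v)) (at y)"
    using DERIV_compose_FDERIV[OF DERIV_rpow_p(1)[OF admissible_u[OF assms]] has_derivative_component]
      DERIV_compose_FDERIV[OF DERIV_rpow_p(2)[OF admissible_u[OF assms], of 1] has_derivative_component]
    by (simp_all add: mult.commute)
  then have "((\<lambda>y. rpow (u y) p * (d_x \<xi> y - d_t \<tau> y) - d_t \<xi> y - p * rpow (u y) (p - 1) * \<eta> y)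
    has_derivative (\<lambda>v. rpow (u y) p * (ddir v (d_x \<xi>) y - ddir v (d_t \<tau>) y)
       + p * rpow (u y) (p - 1) * u v * (d_x \<xi> y - d_t \<tau> y) - ddir v (d_t \<xi>) y
       - (p * rpow (u y) (p - 1) * ddir v \<eta> y + p * (p - 1) * rpow (u y) (p - 2) * u v * \<eta> y))) (at y)"
    by (intro has_derivative_diff has_derivative_mult has_deriv[OF assms] has_deriv_d[OF assms])
  from ddir_identity[OF D(1) assms coefficients_eq_mt(2) this, of v]
  show ?thesis by (simp add: algebra_simps)
qed

text \<open>The x-derivative of the formula for \<phi> gives \<open>d_x \<phi>\<close> = 0, the
  coefficient of u_x^0 in the second condition then gives \<open>d_t \<phi>\<close> = 0, and the
  t-derivative of the formula reduces to \<tau>_tt m = 0. Differentiating by m instead of dividing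
  covers m = 0.\<close>

lemma tau_tt_eq_0:
  assumes "open S" "S \<subseteq> D" "\<And>z. z \<in> S \<Longrightarrow> p * \<phi> z + d_t \<tau> z * m z = 0"
    "\<And>z. z \<in> S \<Longrightarrow> d_x \<eta> z = 0" "p \<noteq> 0" "y \<in> S"
  shows "d_t (d_t \<tau>) y = 0"
proof -
  have d: "p * ddir v \<phi> z + ddir v (d_t \<tau>) z * m z + d_t \<tau> z * m v = 0" if "z \<in> S" for z v
  proof -
    have zD: "z \<in> D" using that assms(2) by blast
    have "((\<lambda>y. p * \<phi> y + d_t \<tau> y * m y) has_derivative
      (\<lambda>v. p * ddir v \<phi> z + (d_t \<tau> z * m v + ddir v (d_t \<tau>) z * m z))) (at z)"
      by (intro has_derivative_add has_derivative_mult has_derivative_mult_right has_deriv[OF zD]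
          has_deriv_d[OF zD] has_derivative_component)
    from ddir_identity[OF assms(1) that assms(3) this, of v] show ?thesis by simp
  qed
  have tt: "d_t (d_t \<tau>) z * m z = 0" if "z \<in> S" for z
  proof -
    have zD: "z \<in> D" using that assms(2) by blast
    have "d_x \<phi> z = 0"
      using d[OF that, of "(0, 1, 0)"] tau_only_t_d[OF zD] assms(5) by simp
    then have "d_t \<phi> z = 0"
      using coefficients_eq_mt(3)[OF zD] assms(4)[OF that] by simp
    then show ?thesis
      using d[OF that, of "(1, 0, 0)"] by simp
  qed
  have yD: "y \<in> D" using assms(2,6) by blast
  have "((\<lambda>y. d_t (d_t \<tau>) y * m y) has_derivative
      (\<lambda>v. d_t (d_t \<tau>) y * m v + ddir v (d_t (d_t \<tau>)) y * m y)) (at y)"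
    by (intro has_derivative_mult has_deriv_dd[OF yD] has_derivative_component)
  from ddir_identity[OF assms(1,6) tt this, of "(0, 0, axis 2 1)"] show ?thesis
    by (simp add: independent_of_m_d[OF yD] axis_component)
qed

text \<open>For p = 1 the coefficients of u_x^2 and u_x^3 say nothing. The coefficient of m_x gives
  \<eta> = u (\<xi>_x - \<tau>_t) - \<xi>_t, so both mixed derivatives of \<eta> equal \<xi>_xx; the
  first condition says that their sum is \<xi>_xx, hence \<xi>_xx = 0. No division by u
  occurs.\<close>

lemma symmetry_p_eq_1:
  assumes "p = 1" "y \<in> D"
  shows "d_x \<xi> y = 0" "d_t \<xi> y = 0" "d_t (d_t \<tau>) y = 0"
    "\<eta> y + d_t \<tau> y * u y = 0" "\<phi> y + d_t \<tau> y * m y = 0"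
proof -
  have h: "rpow v 0 = 1" "rpow v 1 = v" for v
    by (simp_all add: rpow_def)
  have u: "d_u \<eta> z - (d_x \<xi> z - d_t \<tau> z) = 0" if "z \<in> D" for z
    using d_coefficient_m_x[OF that, of "(0, 0, axis 1 1)"] xi_independent_of_u_d[OF that]
      tau_only_t_d[OF that] by (simp add: assms(1) h axis_component)
  have x: "d_x \<eta> z - (u z * d_x (d_x \<xi>) z - d_x (d_t \<xi>) z) = 0" if "z \<in> D" for z
    using d_coefficient_m_x[OF that, of "(0, 1, 0)"] tau_only_t_d[OF that]
    by (simp add: assms(1) h)
  have xi_xx: "d_x (d_x \<xi>) z = 0" if "z \<in> D" for z
  proof -
    have "((\<lambda>y. d_u \<eta> y - (d_x \<xi> y - d_t \<tau> y)) has_derivative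
      (\<lambda>v. ddir v (d_u \<eta>) z - (ddir v (d_x \<xi>) z - ddir v (d_t \<tau>) z))) (at z)"
      by (intro has_derivative_diff has_deriv_d[OF that])
    from ddir_identity[OF D(1) that u this, of "(0, 1, 0)"]
    have "d_x (d_u \<eta>) z = d_x (d_x \<xi>) z"
      using tau_only_t_d[OF that] by simp
    moreover have "((\<lambda>y. d_x \<eta> y - (u y * d_x (d_x \<xi>) y - d_x (d_t \<xi>) y)) has_derivative
      (\<lambda>v. ddir v (d_x \<eta>) z - ((u z * ddir v (d_x (d_x \<xi>)) z + u v * d_x (d_x \<xi>) z)
         - ddir v (d_x (d_t \<xi>)) z))) (at z)"
      by (intro has_derivative_diff has_derivative_mult has_deriv_d[OF that] has_deriv_dd[OF that]
          has_derivative_component)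
    from ddir_identity[OF D(1) that x this, of "(0, 0, axis 1 1)"]
    have "d_u (d_x \<eta>) z = d_x (d_x \<xi>) z"
      using xi_independent_of_u_d[OF that] by (simp add: axis_component)
    ultimately show ?thesis
      using eq_m_coefficients(2)[OF that] xi_independent_of_u[OF that] by simp
  qed
  have eta_xx: "d_x (d_x \<eta>) z + d_x (d_x (d_t \<xi>)) z = 0" if "z \<in> D" for z
  proof -
    have "((\<lambda>y. d_x \<eta> y + d_x (d_t \<xi>) y) has_derivative
      (\<lambda>v. ddir v (d_x \<eta>) z + ddir v (d_x (d_t \<xi>)) z)) (at z)"
      by (intro has_derivative_add has_deriv_d[OF that] has_deriv_dd[OF that])
    from ddir_identity[OF D(1) that _ this] x xi_xx show ?thesis by simp
  qed
  \<comment> \<open>Now \<eta>_xx is minus a derivative of \<xi> and so free of u;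
    \<open>d_phi_u\<close> together with \<phi>_u = 0 leaves 2 \<xi>_x = 0.\<close>
  have xi_x: "d_x \<xi> z = 0" if "z \<in> D" for z
  proof -
    have "((\<lambda>y. d_x (d_x \<eta>) y + d_x (d_x (d_t \<xi>)) y) has_derivative
      (\<lambda>v. ddir v (d_x (d_x \<eta>)) z + ddir v (d_x (d_x (d_t \<xi>))) z)) (at z)"
      by (intro has_derivative_add has_deriv_dd[OF that] has_derivative_ddir
        smooth_on_differentiable[OF _ that] smooth_on_ddir smooth_symmetry)
    from ddir_identity[OF D(1) that eta_xx this, of "(0, 0, axis 1 1)"]
    have "d_u (d_x (d_x \<eta>)) z = 0"
      using xi_independent_of_u_d[OF that] by simp
    then show ?thesis
      using d_phi_u[OF that] coefficients_eq_mt(1)[OF that] by simp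
  qed
  have eta_x: "d_x \<eta> z = 0" if "z \<in> D" for z
    using x[OF that] xi_xx[OF that] ddir_ddir_eq_0[OF D(1) smooth_symmetry(2) xi_x that] by simp
  have eta_xx: "d_x (d_x \<eta>) z = 0" if "z \<in> D" for z
    using ddir_eq_0[OF D(1) that eta_x] .
  \<comment> \<open>From the coefficient of u_x in the second condition, with \<phi>_m = \<eta>_u =
    -\<tau>_t.\<close>
  have phi: "\<phi> z + d_t \<tau> z * m z = 0" if "z \<in> D" for z
    using coefficients_eq_mt(5)[OF that] d_phi_m[OF that] u[OF that] xi_x[OF that]
    by (simp add: assms(1) h algebra_simps)
  have xi_t: "d_t \<xi> z = 0" "\<eta> z + d_t \<tau> z * u z = 0" if "z \<in> D" for z
  proof -
    have "d_u \<eta> z = - d_t \<tau> z" using u[OF that] xi_x[OF that] by simp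
    then have "\<phi> z - \<eta> z - (u z - m z) * d_t \<tau> z = 0"
      using eq_m_coefficients(1)[OF that] eta_xx[OF that] xi_x[OF that] by simp
    moreover have "- (u z * d_t \<tau> z) - d_t \<xi> z - \<eta> z = 0"
      using coefficients_eq_mt(2)[OF that] xi_x[OF that] by (simp add: assms(1) h)
    ultimately show "d_t \<xi> z = 0" "\<eta> z + d_t \<tau> z * u z = 0"
      using phi[OF that] by (simp_all add: algebra_simps)
  qed
  show "d_x \<xi> y = 0" "d_t \<xi> y = 0" "\<eta> y + d_t \<tau> y * u y = 0" "\<phi> y + d_t \<tau> y * m y = 0"
    by (rule xi_x xi_t phi assms)+
  show "d_t (d_t \<tau>) y = 0"
    by (rule tau_tt_eq_0[OF D(1) order.refl _ eta_x]) (use phi assms in simp_all)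
qed

text \<open>Where u is nonzero and p is not 1, u^(p-2) is nonzero and all conditions can be divided
  by it, the other powers being expressed by \<open>h2\<close> and u.\<close>

lemma symmetry_p_neq_1:
  assumes "p \<noteq> 0" "p \<noteq> 1" "y \<in> D" "u y \<noteq> 0"
  shows "d_x \<xi> y = 0" "d_t \<xi> y = 0" "d_t (d_t \<tau>) y = 0"
    "p * \<eta> y + d_t \<tau> y * u y = 0" "p * \<phi> y + d_t \<tau> y * m y = 0"
proof -
  \<comment> \<open>The conditions have to be differentiated, so u is kept nonzero on an open set
    and not just at y.\<close>
  define S where "S = D \<inter> {y. u y \<noteq> 0}"
  have S: "open S" "S \<subseteq> D" "y \<in> S"
  proof -
    have "continuous_on UNIV u" by (intro continuous_intros)
    then have "open {y. u y \<noteq> 0}"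
      by (intro open_Collect_neq) (auto intro: continuous_intros)
    then show "open S" using D(1) by (auto simp: S_def)
  qed (use assms in \<open>auto simp: S_def\<close>)
  have sol: "d_x \<eta> z = 0 \<and> d_x \<xi> z = 0 \<and> d_t \<xi> z = 0 \<and> p * \<eta> z + d_t \<tau> z * u z = 0
      \<and> p * \<phi> z + d_t \<tau> z * m z = 0" if z: "z \<in> S" for z
  proof -
    have h2_neq_0: "rpow (u z) (p - 2) \<noteq> 0" if "z \<in> S" for z
    proof -
      have "u z > 0 \<or> p - 2 \<in> \<int>"
        using admissible_exponents(3)[OF admissible_u, of z] that S(2) assms(2) by blast
      then show ?thesis using rpow_nonzero that by (auto simp: S_def)
    qed
    have zD: "z \<in> D" using z S(2) by blast
    define h0 h1 h2 h3 where h: "h0 = rpow (u z) p" "h1 = rpow (u z) (p - 1)"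
      "h2 = rpow (u z) (p - 2)" "h3 = rpow (u z) (p - 3)"
    have h2: "h2 \<noteq> 0" using h2_neq_0[OF z] by (simp add: h)
    have h1: "h1 = h2 * u z" and h0: "h0 = h2 * u z * u z" and h3: "(p - 2) * h3 * u z = (p - 2) * h2"
      using mult_rpow_p[OF admissible_u[OF zD]] assms(1,2) by (auto simp: h)
    \<comment> \<open>From the coefficient of u_x^2. Valid on the open set S, it can be
      differentiated and yields \<eta>_xxu = 0, which turns \<phi>_u = 0 into \<xi>_x = 0.\<close>
    have eta_x: "d_x \<eta> z = 0" if "z \<in> S" for z
      using coefficients_eq_mt(4)[of z] h2_neq_0[OF that] that S(2) assms(1,2) by auto
    have "d_u (d_x (d_x \<eta>)) z = 0"
      by (rule ddir_eq_0[OF S(1) z] ddir_eq_0[OF S(1)] eta_x | assumption)+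
    then have xi_x: "d_x \<xi> z = 0"
      using d_phi_u[OF zD] coefficients_eq_mt(1)[OF zD] by simp
    have m_x: "h0 * (- d_t \<tau> z) - d_t \<xi> z - p * h1 * \<eta> z = 0"
      using coefficients_eq_mt(2)[OF zD] by (simp add: h xi_x)
    \<comment> \<open>\<open>e1\<close> is the \<open>u\<close>-derivative of the coefficient of \<open>m\<^sub>x\<close>, and \<open>e2\<close> the coefficient of \<open>u\<^sub>x\<^sup>3\<close>\<close>
    have "p * h1 * (- d_t \<tau> z) - (p * (p - 1) * h2 * \<eta> z + p * h1 * d_u \<eta> z) = 0"
      using d_coefficient_m_x[OF zD, of "(0, 0, axis 1 1)"] xi_independent_of_u_d[OF zD]
        tau_only_t_d[OF zD] xi_x by (simp add: h axis_component)
    then have "p * h2 * (u z * d_t \<tau> z + (p - 1) * \<eta> z + u z * d_u \<eta> z) = 0"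
      unfolding h1 by algebra
    then have e1: "u z * d_t \<tau> z + (p - 1) * \<eta> z + u z * d_u \<eta> z = 0"
      using h2 assms(1) by simp
    have "p * (p - 1) * (h2 * (d_u \<eta> z - d_t \<tau> z) - (p - 2) * h3 * \<eta> z - 3 * h2 * d_u \<eta> z) = 0"
      using coefficients_eq_mt(6)[OF zD] d_phi_m[OF zD] by (simp add: h xi_x)
    then have "h2 * (d_u \<eta> z - d_t \<tau> z) - (p - 2) * h3 * \<eta> z - 3 * h2 * d_u \<eta> z = 0"
      using assms(1,2) by simp
    then have "h2 * (u z * d_t \<tau> z + (p - 2) * \<eta> z + 2 * u z * d_u \<eta> z) = 0"
      using h3 by algebra
    then have e2: "u z * d_t \<tau> z + (p - 2) * \<eta> z + 2 * u z * d_u \<eta> z = 0"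
      using h2 by simp
    \<comment> \<open>\<open>e1\<close> minus \<open>e2\<close>: Euler's relation for degree one in
      u.\<close>
    have eta: "\<eta> z = u z * d_u \<eta> z" using e1 e2 by algebra
    have "u z * (d_t \<tau> z + p * d_u \<eta> z) = 0" using e1 eta by algebra
    then have eta_u: "d_t \<tau> z + p * d_u \<eta> z = 0" using z by (simp add: S_def)
    have "d_x (d_x \<eta>) z = 0" by (rule ddir_eq_0[OF S(1) z eta_x])
    then have "\<phi> z - \<eta> z + (u z - m z) * d_u \<eta> z = 0"
      using eq_m_coefficients(1)[OF zD] xi_x by simp
    then have "p * \<phi> z + d_t \<tau> z * m z = 0" using eta eta_u by algebra
    moreover have "p * \<eta> z + d_t \<tau> z * u z = 0" using eta eta_u by algebra
    moreover have "d_t \<xi> z = 0" using m_x eta eta_u unfolding h0 h1 by algebra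
    ultimately show ?thesis using eta_x[OF z] xi_x by blast
  qed
  show "d_x \<xi> y = 0" "d_t \<xi> y = 0" "p * \<eta> y + d_t \<tau> y * u y = 0" "p * \<phi> y + d_t \<tau> y * m y = 0"
    using sol[OF S(3)] by blast+
  show "d_t (d_t \<tau>) y = 0"
    by (rule tau_tt_eq_0[OF S(1,2) _ _ assms(1) S(3)]) (use sol in blast)+
qed

end

section \<open>Extension across u = 0 and global constants\<close>

lemma continuous_eq_0_if_nonzero_u:
  fixes f :: "2 pnt \<Rightarrow> real"
  assumes "open D" "continuous_on D f" "\<And>y. y \<in> D \<Longrightarrow> snd (snd y) $ 1 \<noteq> 0 \<Longrightarrow> f y = 0" "y \<in> D"
  shows "f y = 0"
proof (cases "snd (snd y) $ 1 = 0")
  case True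
  \<comment> \<open>Approach in the u-direction: the n-th point has u = 1/(n+1).\<close>
  define z where "z n = y + inverse (real (Suc n)) *\<^sub>R (0, 0, axis 1 1)" for n
  have z: "z \<longlonglongrightarrow> y"
    unfolding z_def
    using tendsto_add[OF tendsto_const tendsto_scaleR[OF LIMSEQ_inverse_real_of_nat tendsto_const],
        of y "(0, 0, axis 1 1)"] by (simp flip: zero_prod_def)
  have "f \<midarrow>y\<rightarrow> f y"
    using assms(1,2,4) by (simp add: continuous_on_eq_continuous_at isCont_def)
  then have "(\<lambda>n. f (z n)) \<longlonglongrightarrow> f y"
    using isCont_tendsto_compose[OF _ z] by (simp add: isCont_def)
  moreover have "\<forall>\<^sub>F n in sequentially. z n \<in> D"
    using topological_tendstoD[OF z assms(1,4)] .
  then have "\<forall>\<^sub>F n in sequentially. f (z n) = 0"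
    by (rule eventually_mono) (rule assms(3), simp_all add: z_def True axis_component)
  then have "(\<lambda>n. f (z n)) \<longlonglongrightarrow> 0"
    by (rule tendsto_eventually)
  ultimately show ?thesis
    by (rule LIMSEQ_unique)
qed (use assms in blast)

lemma constant_if_ddir_eq_0:
  fixes f :: "2 pnt \<Rightarrow> real"
  assumes "open D" "connected D" "\<And>y. y \<in> D \<Longrightarrow> f differentiable (at y)"
    "\<And>y. y \<in> D \<Longrightarrow> d_t f y = 0" "\<And>y. y \<in> D \<Longrightarrow> d_x f y = 0"
    "\<And>y. y \<in> D \<Longrightarrow> d_u f y = 0" "\<And>y. y \<in> D \<Longrightarrow> d_m f y = 0"
  obtains k where "\<And>y. y \<in> D \<Longrightarrow> f y = k"
proof -
  have "(f has_derivative (\<lambda>v. 0)) (at y)" if "y \<in> D" for y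
  proof -
    have "ddir v f y = 0" for v
      using ddir_2_split[OF assms(3)[OF that], of "fst v" "fst (snd v)" "snd (snd v)"]
        assms(4-7)[OF that] by simp
    then show ?thesis
      using has_derivative_ddir[OF assms(3)[OF that]] by simp
  qed
  then have "f y = f z" if "y \<in> D" "z \<in> D" for y z
    using has_derivative_zero_unique_connected[OF assms(1,2)] that by blast
  then show ?thesis using that by (cases "D = {}") blast+
qed

text \<open>The constants are the values of \<xi>, of \<tau>_t and of \<tau> - k t, named
  \<open>a\<close>, \<open>k\<close> and \<open>b\<close>; each is constant since its derivatives in
  the four coordinate directions vanish on the connected set D.\<close>

lemma symmetry_is_scaling:
  fixes X :: "2 vfield"
  assumes "p \<noteq> 0" and D: "open D" "connected D" "\<forall>(t, x, q)\<in>D. q $ 1 \<in> admissible p"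
    and X: "point_symmetry D (um_system p) X"
  obtains a b c where "\<And>t x q. (t, x, q) \<in> D \<Longrightarrow> X (t, x, q) = (b - c * p * t, a, c *\<^sub>R q)"
proof -
  let ?\<tau> = "\<lambda>y. fst (X y)" and ?\<xi> = "\<lambda>y. fst (snd (X y))"
  let ?\<eta> = "\<lambda>y. snd (snd (X y)) $ 1" and ?\<phi> = "\<lambda>y. snd (snd (X y)) $ 2"
  note ctxt = D(1,3) X
  note s = smooth_symmetry[OF ctxt]
  have "d_x ?\<xi> y = 0 \<and> d_t ?\<xi> y = 0 \<and> d_t (d_t ?\<tau>) y = 0 \<and>
      p * ?\<eta> y + d_t ?\<tau> y * snd (snd y) $ 1 = 0 \<and> p * ?\<phi> y + d_t ?\<tau> y * snd (snd y) $ 2 = 0"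
    if "y \<in> D" "snd (snd y) $ 1 \<noteq> 0" for y
    using symmetry_p_eq_1[OF ctxt _ that(1)] symmetry_p_neq_1[OF ctxt assms(1) _ that]
    by (cases "p = 1") auto
  note local = this
  have cont: "continuous_on D (ddir v ?\<xi>)" "continuous_on D (ddir v ?\<tau>)" "continuous_on D (ddir v (ddir v' ?\<tau>))"
    "continuous_on D ?\<eta>" "continuous_on D ?\<phi>" for v v'
    by (intro smooth_on_imp_continuous_on smooth_on_ddir s)+
  note dense = continuous_eq_0_if_nonzero_u[OF D(1)]
  have xi: "d_x ?\<xi> y = 0" "d_t ?\<xi> y = 0" if "y \<in> D" for y
    by (rule dense[OF cont(1) _ that], use local in blast)+
  have tau: "d_t (d_t ?\<tau>) y = 0" if "y \<in> D" for y
    by (rule dense[OF cont(3) _ that]) (use local in blast)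
  have eta: "p * ?\<eta> y + d_t ?\<tau> y * snd (snd y) $ 1 = 0" if "y \<in> D" for y
    by (rule dense[OF _ _ that]) (use local in \<open>auto intro!: continuous_intros cont\<close>)
  have phi: "p * ?\<phi> y + d_t ?\<tau> y * snd (snd y) $ 2 = 0" if "y \<in> D" for y
    by (rule dense[OF _ _ that]) (use local in \<open>auto intro!: continuous_intros cont\<close>)
  obtain a where a: "\<And>y. y \<in> D \<Longrightarrow> ?\<xi> y = a"
    using constant_if_ddir_eq_0[OF D(1,2) smooth_on_differentiable[OF s(2)] xi(2,1)
        xi_independent_of_u[OF ctxt] independent_of_m(3)[OF ctxt]] by blast
  obtain k where k: "\<And>y. y \<in> D \<Longrightarrow> d_t ?\<tau> y = k"
    using constant_if_ddir_eq_0[OF D(1,2) smooth_on_differentiable[OF smooth_on_ddir[OF s(1)]] tau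
        tau_only_t_d[OF ctxt] independent_of_m_d(2)[OF ctxt]] by blast
  have der: "((\<lambda>y. ?\<tau> y - k * fst y) has_derivative (\<lambda>v. ddir v ?\<tau> y - k * fst v)) (at y)"
    if "y \<in> D" for y
    by (intro has_derivative_diff has_derivative_mult_right has_derivative_fst has_derivative_ident
        has_deriv(1)[OF ctxt that])
  obtain b where b: "\<And>y. y \<in> D \<Longrightarrow> ?\<tau> y - k * fst y = b"
  proof (rule constant_if_ddir_eq_0[OF D(1,2)])
    fix y assume "y \<in> D"
    note d = ddir_eqI[OF der[OF this]]
    show "(\<lambda>y. ?\<tau> y - k * fst y) differentiable (at y)"
      using der[OF \<open>y \<in> D\<close>] by (auto simp: differentiable_def)
    show "d_t (\<lambda>y. ?\<tau> y - k * fst y) y = 0" "d_x (\<lambda>y. ?\<tau> y - k * fst y) y = 0"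
      "d_u (\<lambda>y. ?\<tau> y - k * fst y) y = 0" "d_m (\<lambda>y. ?\<tau> y - k * fst y) y = 0"
      unfolding d using k tau_only_t[OF ctxt] independent_of_m(2)[OF ctxt] \<open>y \<in> D\<close> by simp_all
  qed blast
  show ?thesis
  \<comment> \<open>The scaling rate is -k/p, since -c p t has to equal k t. The instantiation
    follows the order in which b, c, a occur in the goal.\<close>
  proof (rule that[of b "- k / p" a])
    fix t x and q :: "real ^ 2"
    assume y: "(t, x, q) \<in> D"
    have "snd (snd (X (t, x, q))) = (- k / p) *\<^sub>R q"
      using eta[OF y] phi[OF y] k[OF y] assms(1)
      by (auto simp: vec_eq_iff forall_2 field_simps eq_neg_iff_add_eq_0)
    then show "X (t, x, q) = (b - - k / p * p * t, a, (- k / p) *\<^sub>R q)"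
      using a[OF y] b[OF y] assms(1) by (simp add: prod_eq_iff algebra_simps)
  qed
qed

lemma combination_eq:
  "a *\<^sub>R X1 (t, x, q) + b *\<^sub>R X2 (t, x, q) + c *\<^sub>R X3 p (t, x, q) = (b - c * p * t, a, c *\<^sub>R q)"
  by (simp add: X1_def X2_def X3_def vec_eq_iff forall_2 vector_2)

lemma open_drop_m_image:
  fixes D :: "2 pnt set"
  assumes "open D"
  shows "open (drop_m ` D)"
proof (rule open_surjective_linear_image[OF assms])
  show "linear drop_m"
    by (rule linearI) (auto simp: drop_m_def vec_eq_iff vector_def split: prod.splits)
  show "surj drop_m"
  proof (rule surjI)
    \<comment> \<open>A right inverse of the projection; the m-slot is filled with the value of u,
      an arbitrary choice.\<close>
    show "drop_m (fst y, fst (snd y), \<chi> i. snd (snd y) $ 1) = y" for y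
      by (cases y) (simp add: drop_m_def vec_eq_iff forall_1)
  qed
qed

theorem proposition3p1:
  fixes p :: real and D :: "2 pnt set"
  assumes "p \<noteq> 0"
    and "open D" and "connected D"
    and "\<forall>(t, x, q)\<in>D. q $ 1 \<in> admissible p"
  shows "{X. point_symmetry D (um_system p) X} =
           {X. \<exists>a b c. \<forall>z\<in>D. X z = a *\<^sub>R X1 z + b *\<^sub>R X2 z + c *\<^sub>R X3 p z}
       \<and> (\<forall>X. point_symmetry D (um_system p) X \<longrightarrow>
             (\<exists>Y. projects_to D X Y \<and> point_symmetry (drop_m ` D) {eq_u p} Y))"
proof (intro conjI allI impI set_eqI iffI; (elim CollectE)?; (intro CollectI)?)
  fix X
  assume "point_symmetry D (um_system p) X"
  then obtain a b c where X: "\<And>t x q. (t, x, q) \<in> D \<Longrightarrow> X (t, x, q) = (b - c * p * t, a, c *\<^sub>R q)"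
    using symmetry_is_scaling[OF assms] by metis
  then show "\<exists>a b c. \<forall>z\<in>D. X z = a *\<^sub>R X1 z + b *\<^sub>R X2 z + c *\<^sub>R X3 p z"
    by (intro exI[of _ a] exI[of _ b] exI[of _ c] ballI) (auto simp: combination_eq)
next
  fix X
  assume "\<exists>a b c. \<forall>z\<in>D. X z = a *\<^sub>R X1 z + b *\<^sub>R X2 z + c *\<^sub>R X3 p z"
  then obtain a b c where "\<And>z. z \<in> D \<Longrightarrow> X z = a *\<^sub>R X1 z + b *\<^sub>R X2 z + c *\<^sub>R X3 p z"
    by blast
  then show "point_symmetry D (um_system p) X"
    by (intro point_symmetry_scaling_system[OF assms(2,4), of X b c a]) (simp add: combination_eq)
next
  fix X
  assume "point_symmetry D (um_system p) X"
  then obtain a b c where X: "\<And>t x q. (t, x, q) \<in> D \<Longrightarrow> X (t, x, q) = (b - c * p * t, a, c *\<^sub>R q)"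
    using symmetry_is_scaling[OF assms] by metis
  \<comment> \<open>The same formula in one dependent variable; the constants a, b, c do not involve
    m, which is why the projection exists.\<close>
  define Y :: "1 vfield" where "Y = (\<lambda>(t, x, q). (b - c * p * t, a, c *\<^sub>R q))"
  have "projects_to D X Y"
    using X by (auto simp: projects_to_def Y_def drop_m_def vec_eq_iff forall_1)
  moreover have "point_symmetry (drop_m ` D) {eq_u p} Y"
  proof (rule point_symmetry_scaling_eq_u[OF open_drop_m_image[OF assms(2)], where a = a and b = b and c = c])
    show "\<forall>(t, x, q)\<in>drop_m ` D. q $ 1 \<in> admissible p"
      using assms(4) by (auto simp: drop_m_def)
  qed (simp add: Y_def)
  ultimately show "\<exists>Y. projects_to D X Y \<and> point_symmetry (drop_m ` D) {eq_u p} Y"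
    by blast
qed

end
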